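(* Let $b>0$ and $\nu\in(0,1)$. Let $f_{\Gamma_\nu}(x,t)$, $x,t\ge 0$, be the density of the fractional Gamma process $\Gamma_\nu(t)=\Gamma(\mathcal{L}_\nu(t))$, i.e. $f_{\Gamma_\nu}(x,t)=\int_0^\infty f_\Gamma(x,z)\,l_\nu(z,t)\,dz$. Then, for $t>1$, $f_{\Gamma_\nu}$ satisfies the equation $$\frac{\partial}{\partial x}f_{\Gamma_\nu}=-b\,(1-\mathcal{O}^{\nu}_{-1,t})f_{\Gamma_\nu},\qquad x\ge 0,$$ with initial condition $f_{\Gamma_\nu}(0,t)=0$.
   Context: $\Gamma(t)$, $t\ge0$, is the Gamma subordinator with parameter $b>0$, with density $f_\Gamma(x,t)=\frac{b^t}{\Gamma(t)}x^{t-1}e^{-bx}$ for $x\ge0$ and $0$ for $x<0$ (in the formula $\Gamma(t)$ is Euler's Gamma function). For $\nu\in(0,1)$, $\mathcal{A}_\nu$ is the stable subordinator with $\mathbb{E}e^{-k\mathcal{A}_\nu(t)}=e^{-k^\nu t}$, $k>0$, and $\mathcal{L}_\nu(t):=\inf\{z\ge0:\mathcal{A}_\nu(z)>t\}$ is its inverse, taken independent of $\Gamma$; $l_\nu(\cdot,t)$ is the density of $\mathcal{L}_\nu(t)$. The Caputo derivative of order $\nu\in(0,1)$ is $D_t^\nu u(t)=\frac{1}{\Gamma(1-\nu)}\int_0^t (t-s)^{-\nu}\frac{d}{ds}u(s)\,ds$ (with $D^1_t=d/dt$). For a continuous $f:\mathbb{R}^+\to\mathbb{R}$ having such fractional derivatives,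 and $c\in\mathbb{R}$, the fractional shift operator is $\mathcal{O}^\nu_{c,t}f(t):=\sum_{n=0}^\infty\frac{c^n}{n!}\underbrace{D_t^\nu\cdots D_t^\nu}_{n\text{ times}}f(t)$, provided the series converges; here it acts on the variable $t$ for fixed $x$.
   Formalization: The equation is proved for x>0 only: the density is unbounded as x→0+, so no x-derivative exists at x=0. The initial condition f(0,t)=0 is the value of the integral formula with 0^(z-1) read as 0 for every z; it is not a limit as x→0+. *)

theory Defs
  imports "HOL-Probability.Probability"
begin

definition subordinator :: "'a measure \<Rightarrow> (real \<Rightarrow> 'a \<Rightarrow> real) \<Rightarrow> bool" where
  "subordinator M X \<longleftrightarrow>
     prob_space M \<and>
     (\<forall>t\<ge>0. X t \<in> borel_measurable M) \<and>
     (AE \<omega> in M. X 0 \<omega> = 0) \<and>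
     (\<forall>(n::nat) (\<tau>::nat \<Rightarrow> real). 0 \<le> \<tau> 0 \<and> mono \<tau> \<longrightarrow>
        prob_space.indep_vars M (\<lambda>_. borel) (\<lambda>i \<omega>. X (\<tau> (Suc i)) \<omega> - X (\<tau> i) \<omega>) {..<n}) \<and>
     (\<forall>s\<ge>0. \<forall>h\<ge>0. distr M borel (\<lambda>\<omega>. X (s + h) \<omega> - X s \<omega>) = distr M borel (X h)) \<and>
     (AE \<omega> in M. mono_on {0..} (\<lambda>t. X t \<omega>) \<and>
        (\<forall>t\<ge>0. continuous (at_right t) (\<lambda>t. X t \<omega>)))"

text \<open>
  Since \<^term>\<open>0 powr a = (0::real)\<close> for every exponent, the value at \<^term>\<open>x = (0::real)\<close> is 0 for
  every \<^term>\<open>t\<close>; the conventional value is 0 only for \<^term>\<open>t > (1::real)\<close> (for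
  \<^term>\<open>t < (1::real)\<close> the density is unbounded near 0).
\<close>
definition gamma_proc_density :: "real \<Rightarrow> real \<Rightarrow> real \<Rightarrow> real" where
  "gamma_proc_density b x t =
     (if 0 \<le> x then b powr t / Gamma t * x powr (t - 1) * exp (- b * x) else 0)"

definition gamma_subordinator :: "'a measure \<Rightarrow> real \<Rightarrow> (real \<Rightarrow> 'a \<Rightarrow> real) \<Rightarrow> bool" where
  "gamma_subordinator M b X \<longleftrightarrow>
     subordinator M X \<and>
     (\<forall>t>0. distributed M lborel (X t) (\<lambda>x. ennreal (gamma_proc_density b x t)))"

definition stable_subordinator :: "'a measure \<Rightarrow> real \<Rightarrow> (real \<Rightarrow> 'a \<Rightarrow> real) \<Rightarrow> bool" where
  "stable_subordinator M \<nu> X \<longleftrightarrow>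
     subordinator M X \<and>
     (\<forall>t\<ge>0. \<forall>k>0. prob_space.expectation M (\<lambda>\<omega>. exp (- k * X t \<omega>)) = exp (- (k powr \<nu>) * t))"

definition inverse_process :: "(real \<Rightarrow> 'a \<Rightarrow> real) \<Rightarrow> real \<Rightarrow> 'a \<Rightarrow> real" where
  "inverse_process X t \<omega> = Inf {z. 0 \<le> z \<and> X z \<omega> > t}"

definition indep_processes ::
    "'a measure \<Rightarrow> (real \<Rightarrow> 'a \<Rightarrow> real) \<Rightarrow> (real \<Rightarrow> 'a \<Rightarrow> real) \<Rightarrow> bool" where
  "indep_processes M X Y \<longleftrightarrow>
     prob_space.indep_var M
       (PiM {0..} (\<lambda>_. borel)) (\<lambda>\<omega>. \<lambda>t\<in>{0..}. X t \<omega>)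
       (PiM {0..} (\<lambda>_. borel)) (\<lambda>\<omega>. \<lambda>t\<in>{0..}. Y t \<omega>)"

definition caputo :: "real \<Rightarrow> (real \<Rightarrow> real) \<Rightarrow> real \<Rightarrow> real" where
  "caputo \<nu> u t = 1 / Gamma (1 - \<nu>) * (LBINT s:{0<..<t}. (t - s) powr (- \<nu>) * deriv u s)"

definition caputo_differentiable :: "real \<Rightarrow> (real \<Rightarrow> real) \<Rightarrow> real \<Rightarrow> bool" where
  "caputo_differentiable \<nu> u t \<longleftrightarrow>
     (\<forall>s\<in>{0<..<t}. u differentiable at s) \<and>
     set_integrable lborel {0<..<t} (\<lambda>s. (t - s) powr (- \<nu>) * deriv u s)"

text \<open>
  \<open>frac_shift\<close> is meaningful only where \<open>frac_shift_exists\<close> holds: all iterated Caputo derivatives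
  exist on the open half-line (hence \<^term>\<open>u\<close> is continuous there) and the series converges at
  \<^term>\<open>t\<close>.
\<close>
definition frac_shift :: "real \<Rightarrow> real \<Rightarrow> (real \<Rightarrow> real) \<Rightarrow> real \<Rightarrow> real" where
  "frac_shift \<nu> c u t = (\<Sum>n. c ^ n / fact n * (caputo \<nu> ^^ n) u t)"

definition frac_shift_exists :: "real \<Rightarrow> real \<Rightarrow> (real \<Rightarrow> real) \<Rightarrow> real \<Rightarrow> bool" where
  "frac_shift_exists \<nu> c u t \<longleftrightarrow>
     (\<forall>n. \<forall>s>0. caputo_differentiable \<nu> ((caputo \<nu> ^^ n) u) s) \<and>
     summable (\<lambda>n. c ^ n / fact n * (caputo \<nu> ^^ n) u t)"

end

theory Submission
  imports Defs "HOL-Complex_Analysis.Complex_Analysis"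
begin

text \<open>
  Let \<open>g x z\<close> be the density of the Gamma process at the point \<open>x\<close> and time \<open>z\<close>. For fixed \<open>x > 0\<close> it is
  \<open>exp (- b * x) / x * (b * x) powr z / Gamma z\<close>, hence the restriction of an entire function of \<open>z\<close>,
  and the recurrence of the Gamma function gives
  \<open>\<partial>g/\<partial>x (x, z) = - b * (g x z - g x (z - 1))\<close>. The density in question is the expectation of \<open>g x\<close> at
  the inverse stable time. The theorem says that the backward time shift in this equation becomes the
  fractional shift operator once the expectation is taken.

  The link is the expansion of \<open>g x z\<close> in powers of \<open>z\<close>. The inverse process at time \<open>t\<close> is distributed
  like \<open>t powr \<nu> * A 1 powr (-\<nu>)\<close> (\<open>expectation_inverse_process\<close>), a consequence of self-similarity, and
  its \<open>k\<close>-th moment is \<open>fact k * t powr (k * \<nu>) / Gamma (1 + k * \<nu>)\<close>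
  (\<open>stable_subordinator_negative_moments\<close>). If \<open>c k\<close> denotes the \<open>k\<close>-th derivative of \<open>g x\<close> at 0, the density is
  therefore \<open>\<Sum>k. c k * t powr (k * \<nu>) / Gamma (1 + k * \<nu>)\<close>
  (\<open>fractional_gamma_density_eq_frac_series\<close>). On such series the Caputo derivative shifts the
  coefficients by one place (\<open>caputo_frac_series\<close>), exactly as \<open>d/dz\<close> acts on the Taylor coefficients of
  \<open>g x\<close>. Consequently the fractional shift with parameter \<open>-1\<close> replaces the coefficients of \<open>g x z\<close> by those
  of \<open>g x (z - 1)\<close> (\<open>frac_shift_frac_series\<close>), which the recurrence of the Gamma function
  expresses by the \<open>c k\<close> (\<open>rGamma_appell_shift_sums\<close>). Differentiating the same series in \<open>x\<close> produces the
  same coefficients (\<open>has_real_derivative_frac_series_appell\<close>).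

  All exchanges of limits rest on one estimate. The function \<open>1 / Gamma\<close> has order 1 but is not of
  exponential type, so its derivatives at 0 are not exponentially bounded; they are, however, bounded by
  \<open>D * E ^ k * fact k powr \<sigma>\<close> for every \<open>\<sigma> > 0\<close> with suitable \<open>D\<close> and \<open>E\<close> (\<open>rGamma_appell_bound\<close>). Choosing \<open>\<sigma> < \<nu>\<close>, the factor
  \<open>1 / Gamma (1 + k * \<nu>)\<close>, which is of size \<open>fact k powr (-\<nu>)\<close> up to exponential factors, makes all series
  converge absolutely.
\<close>

section \<open>The order of the reciprocal Gamma function\<close>

text \<open>
  The factor is \<open>1 + O(u\<^sup>2)\<close> near the origin and at most \<open>exp (2 * norm u)\<close> everywhere, so any
  exponent between 1 and 2 serves in both regimes. Exponents close to 1 are the ones that matter below.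
\<close>
lemma norm_Weierstrass_factor_le:
  fixes u :: complex
  assumes "1 \<le> \<rho>" "\<rho> \<le> 2"
  shows "norm ((1 + u) * exp (-u)) \<le> exp (9 * norm u powr \<rho>)"
proof (cases "norm u \<le> 1")
  case True
  have "(1 + u) * exp (-u) = 1 - exp (-u) * (exp u - (1 + u))"
    by (simp add: algebra_simps flip: exp_add)
  hence "norm ((1 + u) * exp (-u)) \<le> 1 + norm (exp (-u)) * norm (exp u - (1 + u))"
    by (metis norm_mult norm_one norm_triangle_ineq4)
  also have "norm (exp (-u)) * norm (exp u - (1 + u)) \<le> exp 1 * (exp 1 * norm u ^ 2)"
  proof (rule mult_mono)
    have "norm (exp (-u)) \<le> exp (norm u)" using norm_exp[of "-u"] by simp
    also have "\<dots> \<le> exp 1" using True by simp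
    finally show "norm (exp (-u)) \<le> exp 1" .
    have "norm (exp u - (\<Sum>k\<le>1. u ^ k / fact k)) \<le> exp \<bar>Re u\<bar> * norm u ^ Suc 1 / fact 1"
      by (rule Taylor_exp)
    moreover have "exp \<bar>Re u\<bar> \<le> exp (1::real)"
      using True abs_Re_le_cmod[of u] by simp
    ultimately show "norm (exp u - (1 + u)) \<le> exp 1 * norm u ^ 2"
      by (auto simp: power2_eq_square elim!: order_trans intro!: mult_right_mono)
  qed auto
  finally have *: "norm ((1 + u) * exp (-u)) \<le> 1 + exp 1 * (exp 1 * norm u ^ 2)" by simp
  have B: "norm u ^ 2 \<le> norm u powr \<rho>"
  proof (cases "u = 0")
    case False
    hence "norm u powr 2 \<le> norm u powr \<rho>"
      using assms True by (intro powr_mono') auto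
    thus ?thesis using False by simp
  qed auto
  from * have "norm ((1 + u) * exp (-u)) \<le> 1 + (exp 1 * exp 1) * norm u ^ 2"
    by (simp add: mult.assoc)
  also have "\<dots> \<le> 1 + (3 * 3) * norm u powr \<rho>"
    by (intro add_left_mono mult_mono exp_le B) auto
  also have "1 + 3 * 3 * norm u powr \<rho> \<le> exp (9 * norm u powr \<rho>)"
    using exp_ge_add_one_self[of "9 * norm u powr \<rho>"] by simp
  finally show ?thesis by simp
next
  case False
  have "norm ((1 + u) * exp (-u)) \<le> exp (norm u) * exp (norm u)"
    unfolding norm_mult
  proof (intro mult_mono)
    show "norm (1 + u) \<le> exp (norm u)"
      using norm_triangle_ineq[of 1 u] exp_ge_add_one_self[of "norm u"] by (simp only: norm_one)
    show "norm (exp (- u)) \<le> exp (norm u)"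
      using norm_exp[of "-u"] by simp
  qed auto
  also have "\<dots> = exp (2 * norm u powr 1)"
    by (simp flip: exp_add)
  also have "norm u powr 1 \<le> norm u powr \<rho>"
    using False assms by (intro powr_mono) auto
  also have "exp (2 * norm u powr \<rho>) \<le> exp (9 * norm u powr \<rho>)"
    by simp
  finally show ?thesis by simp
qed

lemma le_one_plus_powr:
  fixes x \<rho> :: real
  assumes "0 \<le> x" "1 \<le> \<rho>"
  shows "x \<le> 1 + x powr \<rho>"
proof (cases "x \<le> 1")
  case False
  hence "x powr 1 \<le> x powr \<rho>" using assms by (intro powr_mono) auto
  thus ?thesis using False by simp
qed (use powr_ge_zero[of x \<rho>] in linarith)

text \<open>
  The reciprocal Gamma function has order at most \<open>\<rho>\<close> for every \<open>\<rho> > 1\<close>: its Weierstrass product can be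
  bounded factor by factor, because the exponents \<open>norm z powr \<rho> * k powr (-\<rho>)\<close> are summable over \<open>k\<close>.
\<close>
lemma norm_rGamma_le_exp_powr:
  assumes "1 < \<rho>" "\<rho> \<le> 2"
  shows "\<exists>D\<ge>0. \<forall>z::complex. norm (rGamma z) \<le> exp (D * (1 + norm z powr \<rho>))"
proof -
  \<comment> \<open>the constants collect the bounds for the factor \<open>z\<close>, for \<open>exp (euler_mascheroni * z)\<close> and for the product\<close>
  define Z where "Z = (\<Sum>k. real k powr (-\<rho>))"
  have summ: "summable (\<lambda>k. real k powr (-\<rho>))"
    using assms by (subst summable_real_powr_iff) auto
  have Z0: "0 \<le> Z" unfolding Z_def by (intro suminf_nonneg summ) auto
  define g where "g = \<bar>euler_mascheroni :: real\<bar>"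
  define D where "D = 1 + g + 9 * Z"
  have "norm (rGamma z) \<le> exp (D * (1 + norm z powr \<rho>))" for z :: complex
  proof (rule LIMSEQ_le_const2)
    show "(\<lambda>n. norm (rGamma_series_Weierstrass z n)) \<longlonglongrightarrow> norm (rGamma z)"
      by (intro tendsto_norm rGamma_Weierstrass_complex)
    define p where "p = norm z powr \<rho>"
    have "norm (rGamma_series_Weierstrass z n) \<le> exp (D * (1 + p))" for n
    proof -
      have 1: "norm (\<Prod>k=1..n. (1 + z / of_nat k) * exp (- z / of_nat k)) \<le> exp (9 * Z * p)"
      proof -
        have "norm (\<Prod>k=1..n. (1 + z / of_nat k) * exp (- z / of_nat k))
            = (\<Prod>k=1..n. norm ((1 + z / of_nat k) * exp (- (z / of_nat k))))"
          by (simp add: prod_norm)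
        also have "\<dots> \<le> (\<Prod>k=1..n. exp (9 * p * real k powr (-\<rho>)))"
        proof (intro prod_mono conjI)
          fix k assume "k \<in> {1..n}"
          have "norm ((1 + z / of_nat k) * exp (- (z / of_nat k))) \<le> exp (9 * norm (z / of_nat k) powr \<rho>)"
            using assms by (intro norm_Weierstrass_factor_le) auto
          also have "norm (z / of_nat k) powr \<rho> = p * real k powr (-\<rho>)"
            by (simp add: norm_divide p_def powr_divide powr_minus field_simps)
          finally show "norm ((1 + z / of_nat k) * exp (- (z / of_nat k))) \<le> exp (9 * p * real k powr (-\<rho>))"
            by (simp add: mult.assoc)
        qed auto
        also have "\<dots> = exp (9 * p * (\<Sum>k=1..n. real k powr (-\<rho>)))"
          by (simp add: exp_sum sum_distrib_left)
        also have "\<dots> \<le> exp (9 * p * Z)"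
          unfolding Z_def exp_le_cancel_iff
          by (intro mult_left_mono sum_le_suminf summ) (auto simp: p_def)
        finally show ?thesis by (simp add: mult_ac)
      qed
      have 2: "norm z \<le> exp (norm z)"
        using exp_ge_add_one_self[of "norm z"] by linarith
      have 3: "norm (exp (euler_mascheroni * z)) \<le> exp (g * norm z)"
      proof -
        have "norm (exp (euler_mascheroni * z)) \<le> exp (norm (euler_mascheroni * z))"
          by (rule norm_exp)
        also have "norm (euler_mascheroni * z) = g * norm z"
          by (simp add: g_def norm_mult) (metis norm_of_real of_real_euler_mascheroni)
        finally show ?thesis .
      qed
      have "norm (rGamma_series_Weierstrass z n) \<le> exp (g * norm z) * exp (norm z) * exp (9 * Z * p)"
        unfolding rGamma_series_Weierstrass_def norm_mult
        by (intro mult_mono 1 2 3) auto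
      also have "\<dots> = exp ((1 + g) * norm z + 9 * Z * p)"
        by (simp add: algebra_simps flip: exp_add)
      also have "(1 + g) * norm z + 9 * Z * p \<le> (1 + g) * (1 + p) + 9 * Z * (1 + p)"
        using le_one_plus_powr[of "norm z" \<rho>] assms Z0
        by (intro add_mono mult_left_mono) (auto simp: p_def g_def)
      also have "\<dots> = D * (1 + p)"
        by (simp add: D_def algebra_simps)
      finally show ?thesis by simp
    qed
    thus "\<exists>N. \<forall>n\<ge>N. norm (rGamma_series_Weierstrass z n) \<le> exp (D * (1 + p))"
      by auto
  qed
  moreover have "D \<ge> 0" using Z0 by (simp add: D_def g_def)
  ultimately show ?thesis by blast
qed

section \<open>Taylor coefficients of the Gamma density in its time parameter\<close>

text \<open>
  With \<open>q = ln (b * x)\<close>, the density of the Gamma process at \<open>x\<close> is \<open>exp (- b * x) / x\<close> times this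
  function, which continues it from positive times to an entire function of the time parameter \<open>z\<close>.
\<close>
definition exp_rGamma :: "real \<Rightarrow> complex \<Rightarrow> complex" where
  "exp_rGamma q z = exp (of_real q * z) * rGamma z"

text \<open>
  As functions of \<open>q\<close> these are the Appell polynomials with exponential generating function
  \<open>exp (q * z) / Gamma z\<close>. The derivatives are in fact real; taking the real part saves proving it, and
  all relations used below are linear with real coefficients.
\<close>
definition rGamma_appell :: "nat \<Rightarrow> real \<Rightarrow> real" where
  "rGamma_appell k q = Re ((deriv ^^ k) (exp_rGamma q) 0)"

lemma holomorphic_exp_rGamma: "exp_rGamma q holomorphic_on A"
  unfolding exp_rGamma_def[abs_def] by (intro holomorphic_intros)

lemma rGamma_appell_sums:
  "(\<lambda>k. rGamma_appell k q / fact k * z ^ k) sums (exp (q * z) * rGamma z)"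
proof -
  have "(\<lambda>k. (deriv ^^ k) (exp_rGamma q) 0 / fact k * (of_real z - 0) ^ k) sums exp_rGamma q (of_real z)"
    by (rule holomorphic_power_series[OF holomorphic_exp_rGamma, of _ _ "\<bar>z\<bar> + 1"]) auto
  hence "(\<lambda>k. Re ((deriv ^^ k) (exp_rGamma q) 0 / fact k * of_real z ^ k)) sums Re (exp_rGamma q (of_real z))"
    by (intro sums_Re) simp
  also have "(\<lambda>k. Re ((deriv ^^ k) (exp_rGamma q) 0 / fact k * of_real z ^ k))
      = (\<lambda>k. rGamma_appell k q / fact k * z ^ k)"
  proof
    fix k
    have "(deriv ^^ k) (exp_rGamma q) 0 / fact k * of_real z ^ k
        = of_real (z ^ k / fact k) * (deriv ^^ k) (exp_rGamma q) 0"
      by simp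
    thus "Re ((deriv ^^ k) (exp_rGamma q) 0 / fact k * of_real z ^ k) = rGamma_appell k q / fact k * z ^ k"
      by (simp only: rGamma_appell_def Re_complex_of_real Im_complex_of_real times_complex.sel) simp
  qed
  also have "exp_rGamma q (of_real z) = of_real (exp (q * z) * rGamma z)"
    by (simp add: exp_rGamma_def rGamma_complex_of_real flip: exp_of_real)
  finally show ?thesis by (simp only: Re_complex_of_real)
qed

text \<open>
  Cauchy's inequality on the circle of radius \<open>R = (k + 1) powr (1 - \<sigma>)\<close>. For the order
  \<open>\<rho> = 1 / (1 - \<sigma>)\<close> this choice gives \<open>R powr \<rho> = k + 1\<close>, so the maximum on the circle grows only
  exponentially in \<open>k\<close>, while \<open>R ^ k\<close> dominates \<open>fact k powr (1 - \<sigma>)\<close>. The constants are uniform for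
  bounded \<open>q\<close> so that series in these coefficients can be differentiated in \<open>q\<close>.
\<close>
lemma rGamma_appell_bound:
  assumes "0 < \<sigma>" "\<sigma> \<le> 1/2" "0 \<le> Q"
  shows "\<exists>D\<ge>0. \<exists>E\<ge>1. \<forall>q k. \<bar>q\<bar> \<le> Q \<longrightarrow> \<bar>rGamma_appell k q\<bar> \<le> D * E ^ k * fact k powr \<sigma>"
proof -
  define \<rho> where "\<rho> = 1 / (1 - \<sigma>)"
  have \<rho>: "1 < \<rho>" "\<rho> \<le> 2" using assms by (auto simp: \<rho>_def field_simps)
  then obtain D0 where D0: "D0 \<ge> 0" "\<And>z::complex. norm (rGamma z) \<le> exp (D0 * (1 + norm z powr \<rho>))"
    using norm_rGamma_le_exp_powr by blast
  define D where "D = Q + D0"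
  have D: "D \<ge> 0" using D0 assms by (simp add: D_def)
  have bound: "norm (exp_rGamma q z) \<le> exp (D * (1 + norm z powr \<rho>))" if q: "\<bar>q\<bar> \<le> Q" for q z
  proof -
    have "norm (exp (of_real q * z)) \<le> exp (norm (of_real q * z))"
      by (rule norm_exp)
    also have "norm (of_real q * z) = \<bar>q\<bar> * norm z"
      by (simp add: norm_mult)
    also have "exp (\<bar>q\<bar> * norm z) \<le> exp (Q * (1 + norm z powr \<rho>))"
      using q \<rho> assms le_one_plus_powr[of "norm z" \<rho>] unfolding exp_le_cancel_iff by (intro mult_mono) auto
    finally have "norm (exp_rGamma q z) \<le> exp (Q * (1 + norm z powr \<rho>)) * exp (D0 * (1 + norm z powr \<rho>))"
      unfolding exp_rGamma_def norm_mult by (intro mult_mono D0) auto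
    also have "\<dots> = exp (D * (1 + norm z powr \<rho>))"
      by (simp add: D_def algebra_simps flip: exp_add)
    finally show ?thesis .
  qed
  have "\<bar>rGamma_appell k q\<bar> \<le> exp (2 * D) * exp D ^ k * fact k powr \<sigma>" if q: "\<bar>q\<bar> \<le> Q" for q k
  proof -
    define R where "R = (real k + 1) powr (1 - \<sigma>)"
    have R: "R > 0" by (simp add: R_def)
    have R\<rho>: "R powr \<rho> = real k + 1"
      using assms by (simp add: R_def \<rho>_def powr_powr)
    have "norm ((deriv ^^ k) (exp_rGamma q) 0) \<le> fact k * exp (D * (2 + real k)) / R ^ k"
    proof (rule Cauchy_inequality)
      show "norm (exp_rGamma q x) \<le> exp (D * (2 + real k))" if "norm (0 - x) = R" for x
        using bound[OF q, of x] that R\<rho> by (simp add: add_ac)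
    qed (use R in \<open>auto intro!: holomorphic_on_imp_continuous_on holomorphic_exp_rGamma\<close>)
    also have "\<dots> \<le> fact k * exp (D * (2 + real k)) / fact k powr (1 - \<sigma>)"
    proof (rule divide_left_mono)
      have "fact k \<le> real (k ^ k)" by (rule fact_le_power)
      also have "\<dots> \<le> (real k + 1) ^ k"
        by (simp add: power_mono)
      finally have "fact k powr (1 - \<sigma>) \<le> ((real k + 1) ^ k) powr (1 - \<sigma>)"
        using assms by (intro powr_mono2) auto
      also have "\<dots> = R ^ k"
        by (simp add: R_def powr_powr mult.commute flip: powr_realpow)
      finally show "fact k powr (1 - \<sigma>) \<le> R ^ k" .
    qed (use R in auto)
    also have "\<dots> = exp (D * (2 + real k)) * fact k powr \<sigma>"
      by (simp add: powr_diff)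
    also have "exp (D * (2 + real k)) = exp (2 * D) * exp D ^ k"
      by (simp add: distrib_left exp_add mult_ac flip: exp_of_nat_mult)
    finally show ?thesis
      unfolding rGamma_appell_def using abs_Re_le_cmod order_trans by blast
  qed
  moreover have "exp D \<ge> 1" using D by simp
  ultimately show ?thesis by (intro exI[of _ "exp (2 * D)"] conjI exI[of _ "exp D"]) auto
qed

text \<open>
  The left-hand side is the Taylor series about 0 of the \<open>k\<close>-th derivative of the generating function,
  evaluated at \<open>-1\<close>. The functional equation \<open>1 / Gamma (z - 1) = (z - 1) / Gamma z\<close> rewrites that
  derivative at \<open>-1\<close> through derivatives at 0. This identity is the source of the equation for the
  density: shifting the time parameter by \<open>-1\<close> amounts to multiplying by a linear function of it.
\<close>
lemma rGamma_appell_shift_sums: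
  "(\<lambda>n. (-1) ^ n / fact n * rGamma_appell (k + n) q) sums
     (exp (-q) * (real k * rGamma_appell (k - 1) q - rGamma_appell k q))"
proof -
  let ?H = "exp_rGamma q"
  have hol: "(deriv ^^ k) ?H holomorphic_on ball 0 2"
    by (intro holomorphic_higher_deriv holomorphic_exp_rGamma) auto
  have "(\<lambda>n. (deriv ^^ n) ((deriv ^^ k) ?H) 0 / fact n * (-1 - 0) ^ n) sums (deriv ^^ k) ?H (-1)"
    by (rule holomorphic_power_series[OF hol]) auto
  hence 1: "(\<lambda>n. (-1) ^ n / fact n * (deriv ^^ (k + n)) ?H 0) sums (deriv ^^ k) ?H (-1)"
    by (simp add: funpow_add[symmetric, THEN fun_cong, unfolded o_def] add.commute mult.commute)
  have ident: "(deriv ^^ k) (\<lambda>w. w * ?H w) 0 = of_nat k * (deriv ^^ (k - 1)) ?H 0"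
  proof -
    have "(deriv ^^ k) (\<lambda>w. w * ?H w) 0 =
        (\<Sum>i=0..k. of_nat (k choose i) * (deriv ^^ i) (\<lambda>w. w) 0 * (deriv ^^ (k - i)) ?H 0)"
      by (rule higher_deriv_mult[of _ UNIV]) (auto intro!: holomorphic_intros holomorphic_exp_rGamma)
    also have "\<dots> = (\<Sum>i=0..k. if i = 1 then of_nat k * (deriv ^^ (k - 1)) ?H 0 else 0)"
      by (intro sum.cong) (auto simp: higher_deriv_ident)
    also have "\<dots> = of_nat k * (deriv ^^ (k - 1)) ?H 0"
      by (cases k) auto
    finally show ?thesis .
  qed
  have "(deriv ^^ k) ?H (-1) = (deriv ^^ k) (\<lambda>w. ?H (1 * w + (-1))) 0"
    by (subst higher_deriv_compose_linear'[of _ UNIV UNIV]) (auto intro!: holomorphic_exp_rGamma)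
  also have "(\<lambda>w. ?H (1 * w + (-1))) = (\<lambda>w. of_real (exp (-q)) * (w * ?H w - ?H w))"
  proof
    fix w :: complex
    have "rGamma (w - 1) = (w - 1) * rGamma w"
      using rGamma_plus1[of "w - 1"] by simp
    moreover have "exp (of_real q * (w - 1)) = of_real (exp (-q)) * exp (of_real q * w)"
      by (simp add: right_diff_distrib exp_diff exp_minus field_simps flip: exp_of_real)
    ultimately have "?H (1 * w + (-1)) = (of_real (exp (-q)) * exp (of_real q * w)) * ((w - 1) * rGamma w)"
      by (simp add: exp_rGamma_def)
    also have "\<dots> = of_real (exp (-q)) * (w * ?H w - ?H w)"
      unfolding exp_rGamma_def by (simp only: algebra_simps mult_1_left)
    finally show "?H (1 * w + (-1)) = of_real (exp (-q)) * (w * ?H w - ?H w)" .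
  qed
  also have "(deriv ^^ k) \<dots> 0 = of_real (exp (-q)) * (deriv ^^ k) (\<lambda>w. w * ?H w - ?H w) 0"
    by (rule higher_deriv_cmult[of _ UNIV]) (auto intro!: holomorphic_intros holomorphic_exp_rGamma)
  also have "(deriv ^^ k) (\<lambda>w. w * ?H w - ?H w) 0 = (deriv ^^ k) (\<lambda>w. w * ?H w) 0 - (deriv ^^ k) ?H 0"
    by (rule higher_deriv_diff[of _ UNIV]) (auto intro!: holomorphic_intros holomorphic_exp_rGamma)
  also note ident
  finally have 2: "Re ((deriv ^^ k) ?H (-1)) = exp (-q) * (real k * rGamma_appell (k - 1) q - rGamma_appell k q)"
    by (simp add: rGamma_appell_def)
  have "(\<lambda>n. Re ((-1) ^ n / fact n * (deriv ^^ (k + n)) ?H 0)) sums Re ((deriv ^^ k) ?H (-1))"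
    by (rule sums_Re[OF 1])
  also have "(\<lambda>n. Re ((-1) ^ n / fact n * (deriv ^^ (k + n)) ?H 0)) = (\<lambda>n. (-1) ^ n / fact n * rGamma_appell (k + n) q)"
  proof
    fix n
    have "(-1) ^ n / fact n = complex_of_real ((-1) ^ n / fact n)" by simp
    thus "Re ((-1) ^ n / fact n * (deriv ^^ (k + n)) ?H 0) = (-1) ^ n / fact n * rGamma_appell (k + n) q"
      unfolding rGamma_appell_def by (simp only: Re_complex_of_real times_complex.sel Im_complex_of_real)
  qed
  finally show ?thesis unfolding 2 .
qed

text \<open>
  The Appell property: differentiation in \<open>q\<close> multiplies the generating function by \<open>z\<close>. Leibniz' rule
  makes the polynomial dependence on \<open>q\<close> explicit.
\<close>
lemma has_real_derivative_rGamma_appell: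
  "(rGamma_appell k has_real_derivative real k * rGamma_appell (k - 1) q) (at q)"
proof -
  define r where "r i = Re ((deriv ^^ i) rGamma (0::complex))" for i
  have exp_deriv: "(deriv ^^ n) exp = (exp :: complex \<Rightarrow> complex)" for n
    by (induction n) (auto intro!: ext DERIV_imp_deriv DERIV_exp)
  have exp_deriv0: "(deriv ^^ i) (\<lambda>w. exp (of_real q * w)) 0 = complex_of_real q ^ i" for i q
    by (subst higher_deriv_compose_linear[of _ UNIV UNIV]) (auto intro!: holomorphic_intros simp: exp_deriv)
  have eq: "rGamma_appell k q = (\<Sum>i=0..k. real (k choose i) * q ^ i * r (k - i))" for k q
  proof -
    have "(deriv ^^ k) (exp_rGamma q) 0 =
       (\<Sum>i=0..k. of_nat (k choose i) * (deriv ^^ i) (\<lambda>w. exp (of_real q * w)) 0 * (deriv ^^ (k - i)) rGamma 0)"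
      unfolding exp_rGamma_def[abs_def]
      by (rule higher_deriv_mult[of _ UNIV]) (auto intro!: holomorphic_intros)
    also have "\<dots> = (\<Sum>i=0..k. of_real (real (k choose i) * q ^ i) * (deriv ^^ (k - i)) rGamma 0)"
      by (simp add: exp_deriv0)
    also have "Re \<dots> = (\<Sum>i=0..k. real (k choose i) * q ^ i * r (k - i))"
      unfolding Re_sum r_def by (simp only: Re_complex_of_real Im_complex_of_real times_complex.sel mult_zero_left diff_zero)
    finally show ?thesis
      unfolding rGamma_appell_def .
  qed
  show ?thesis
  proof (cases k)
    case 0
    have "rGamma_appell 0 = (\<lambda>_. r 0)" by (simp add: eq fun_eq_iff)
    thus ?thesis using 0 by simp
  next
    case (Suc m)
    have "((\<lambda>q. \<Sum>i=0..k. real (k choose i) * q ^ i * r (k - i)) has_real_derivative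
           (\<Sum>i=0..k. real (k choose i) * (real i * q ^ (i - 1)) * r (k - i))) (at q)"
      by (intro DERIV_sum DERIV_cmult_right DERIV_cmult) (auto intro!: derivative_eq_intros)
    also have "(\<Sum>i=0..k. real (k choose i) * (real i * q ^ (i - 1)) * r (k - i))
       = (\<Sum>j=0..m. real (Suc m choose Suc j) * (real (Suc j) * q ^ j) * r (m - j))"
      unfolding Suc by (subst sum.atLeast0_atMost_Suc_shift) simp
    also have "\<dots> = (\<Sum>j=0..m. real (Suc m) * (real (m choose j) * q ^ j * r (m - j)))"
    proof (intro sum.cong refl)
      fix j
      have "real (Suc m choose Suc j) * real (Suc j) = real (Suc m) * real (m choose j)"
        by (metis Suc_times_binomial_eq of_nat_mult)
      thus "real (Suc m choose Suc j) * (real (Suc j) * q ^ j) * r (m - j)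
          = real (Suc m) * (real (m choose j) * q ^ j * r (m - j))"
        by (metis mult.assoc)
    qed
    also have "\<dots> = real k * rGamma_appell (k - 1) q"
      by (simp add: eq Suc sum_distrib_left del: of_nat_Suc)
    moreover have "rGamma_appell k = (\<lambda>q. \<Sum>i=0..k. real (k choose i) * q ^ i * r (k - i))"
      by (rule ext) (rule eq)
    ultimately show ?thesis by simp
  qed
qed

section \<open>Sequences of Gevrey growth\<close>

text \<open>
  For \<open>\<sigma> < \<nu>\<close> this growth is slow enough for \<open>\<Sum>k. c k * T ^ k / Gamma (1 + k * \<nu>)\<close> to converge for every
  \<open>T\<close>. A purely exponential bound would be too restrictive: \<open>1 / Gamma\<close> is not of exponential type, so
  its derivatives at 0 do not satisfy one.
\<close>
definition gevrey :: "real \<Rightarrow> (nat \<Rightarrow> real) \<Rightarrow> bool" where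
  "gevrey \<sigma> c \<longleftrightarrow> (\<exists>D\<ge>0. \<exists>E\<ge>1. \<forall>k. \<bar>c k\<bar> \<le> D * E ^ k * fact k powr \<sigma>)"

lemma summable_power_times_fact_powr:
  fixes Q \<delta> :: real
  assumes "0 < \<delta>" "0 \<le> Q"
  shows "summable (\<lambda>k. Q ^ k * fact k powr (-\<delta>))"
proof -
  have "((\<lambda>k. Q * real (Suc k) powr (-\<delta>)) \<longlongrightarrow> Q * 0) sequentially"
    by (intro tendsto_intros tendsto_neg_powr filterlim_compose[OF filterlim_real_sequentially filterlim_Suc])
       (use assms in auto)
  hence "eventually (\<lambda>k. Q * real (Suc k) powr (-\<delta>) < 1/2) sequentially"
    by (rule order_tendstoD) auto
  then obtain N where N: "\<And>k. k \<ge> N \<Longrightarrow> Q * real (Suc k) powr (-\<delta>) < 1/2"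
    unfolding eventually_sequentially by blast
  show ?thesis
  proof (rule summable_ratio_test[of "1/2" N])
    fix k assume k: "k \<ge> N"
    have "Q ^ Suc k * fact (Suc k) powr (-\<delta>) = (Q * real (Suc k) powr (-\<delta>)) * (Q ^ k * fact k powr (-\<delta>))"
      by (simp add: powr_mult del: of_nat_Suc)
    also have "\<dots> \<le> 1/2 * (Q ^ k * fact k powr (-\<delta>))"
      using N[OF k] assms by (intro mult_right_mono) auto
    finally show "norm (Q ^ Suc k * fact (Suc k) powr (-\<delta>)) \<le> 1/2 * norm (Q ^ k * fact k powr (-\<delta>))"
      using assms by simp
  qed auto
qed

text \<open>
  Restrict Euler's integral to \<open>{R..}\<close> and bound the power in it from below by \<open>R powr p\<close>.
\<close>
lemma powr_times_exp_le_Gamma: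
  fixes p R :: real
  assumes "0 \<le> p" "0 \<le> R"
  shows "R powr p * exp (-R) \<le> Gamma (1 + p)"
proof -
  have 1: "((\<lambda>x::real. exp (-1 * x)) has_integral exp (-1 * R) / 1) {R..}"
    by (rule has_integral_exp_minus_to_infinity) auto
  have "((\<lambda>x. R powr p * exp (-1 * x)) has_integral R powr p * (exp (-1 * R) / 1)) {R..}"
    by (rule has_integral_mult_right[OF 1])
  hence "((\<lambda>x. if x \<in> {R..} then R powr p * exp (-x) else 0) has_integral R powr p * exp (-R)) {0..}"
    using assms by (subst has_integral_restrict) auto
  moreover have "((\<lambda>t. t powr (1 + p - 1) / exp t) has_integral Gamma (1 + p)) {0..}"
    by (rule Gamma_integral_real) (use assms in auto)
  moreover have "(if x \<in> {R..} then R powr p * exp (-x) else 0) \<le> x powr (1 + p - 1) / exp x"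
    if "x \<in> {0..}" for x
    using assms by (auto simp: exp_minus field_simps intro!: powr_mono2)
  ultimately show ?thesis by (rule has_integral_le)
qed

lemma inverse_Gamma_le:
  assumes "0 < \<nu>"
  shows "1 / Gamma (1 + real k * \<nu>) \<le> exp 1 * (exp 1 ^ k * fact k powr (-\<nu>))"
proof -
  have pos: "Gamma (1 + real k * \<nu>) > 0"
    using assms by (intro Gamma_real_pos add_pos_nonneg) auto
  have "fact k \<le> real (k ^ k)" by (rule fact_le_power)
  also have "\<dots> \<le> (real k + 1) ^ k" by (simp add: power_mono)
  finally have "fact k powr \<nu> \<le> ((real k + 1) ^ k) powr \<nu>"
    using assms by (intro powr_mono2) auto
  also have "\<dots> = (real k + 1) powr (real k * \<nu>)"
    by (simp add: powr_powr flip: powr_realpow)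
  finally have "fact k powr \<nu> * exp (- (real k + 1)) \<le> (real k + 1) powr (real k * \<nu>) * exp (- (real k + 1))"
    by simp
  also have "\<dots> \<le> Gamma (1 + real k * \<nu>)"
    using assms by (intro powr_times_exp_le_Gamma) auto
  finally have "1 / Gamma (1 + real k * \<nu>) \<le> 1 / (fact k powr \<nu> * exp (- (real k + 1)))"
    using pos by (intro divide_left_mono) auto
  also have "\<dots> = exp (real k + 1) * fact k powr (-\<nu>)"
    by (simp only: exp_minus powr_minus) (simp add: field_simps)
  also have "exp (real k + 1) = exp 1 * exp 1 ^ k"
    by (simp add: exp_add flip: exp_of_nat_mult)
  finally show ?thesis by (simp only: mult.assoc)
qed

lemma summable_gevrey_bound:
  assumes "\<sigma> < \<nu>" "0 < \<nu>" "0 \<le> E" "0 \<le> T"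
  shows "summable (\<lambda>k. E ^ k * fact k powr \<sigma> * T ^ k / Gamma (1 + real k * \<nu>))"
proof (rule summable_comparison_test')
  show "summable (\<lambda>k. exp 1 * ((E * T * exp 1) ^ k * fact k powr (-(\<nu> - \<sigma>))))"
    using assms by (intro summable_mult summable_power_times_fact_powr) auto
  fix k :: nat
  have pos: "Gamma (1 + real k * \<nu>) > 0"
    using assms by (intro Gamma_real_pos add_pos_nonneg) auto
  have "norm (E ^ k * fact k powr \<sigma> * T ^ k / Gamma (1 + real k * \<nu>))
      = E ^ k * fact k powr \<sigma> * T ^ k * (1 / Gamma (1 + real k * \<nu>))"
    using assms pos by simp
  also have "\<dots> \<le> E ^ k * fact k powr \<sigma> * T ^ k * (exp 1 * (exp 1 ^ k * fact k powr (-\<nu>)))"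
    using assms by (intro mult_left_mono inverse_Gamma_le) auto
  also have "\<dots> = exp 1 * ((E * T * exp 1) ^ k * fact k powr (-(\<nu> - \<sigma>)))"
  proof -
    have "fact k powr (-(\<nu> - \<sigma>)) = fact k powr \<sigma> * (fact k powr (-\<nu>) :: real)"
      by (simp flip: powr_add)
    thus ?thesis by (simp add: power_mult_distrib mult_ac)
  qed
  finally show "norm (E ^ k * fact k powr \<sigma> * T ^ k / Gamma (1 + real k * \<nu>))
      \<le> exp 1 * ((E * T * exp 1) ^ k * fact k powr (-(\<nu> - \<sigma>)))" .
qed

lemma summable_gevrey:
  assumes "gevrey \<sigma> c" "\<sigma> < \<nu>" "0 < \<nu>" "0 \<le> T"
  shows "summable (\<lambda>k. \<bar>c k\<bar> * T ^ k / Gamma (1 + real k * \<nu>))"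
proof -
  from assms(1) obtain D E where DE: "D \<ge> 0" "E \<ge> 1" "\<And>k. \<bar>c k\<bar> \<le> D * E ^ k * fact k powr \<sigma>"
    unfolding gevrey_def by blast
  show ?thesis
  proof (rule summable_comparison_test')
    show "summable (\<lambda>k. D * (E ^ k * fact k powr \<sigma> * T ^ k / Gamma (1 + real k * \<nu>)))"
      using assms DE by (intro summable_mult summable_gevrey_bound) auto
    fix k :: nat
    have pos: "Gamma (1 + real k * \<nu>) > 0"
      using assms by (intro Gamma_real_pos add_pos_nonneg) auto
    have "\<bar>c k\<bar> * T ^ k / Gamma (1 + real k * \<nu>) \<le> (D * E ^ k * fact k powr \<sigma>) * T ^ k / Gamma (1 + real k * \<nu>)"
      using pos assms by (intro divide_right_mono mult_right_mono DE) auto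
    thus "norm (\<bar>c k\<bar> * T ^ k / Gamma (1 + real k * \<nu>)) \<le> D * (E ^ k * fact k powr \<sigma> * T ^ k / Gamma (1 + real k * \<nu>))"
      using pos assms by (simp add: mult_ac)
  qed
qed

text \<open>
  Since \<open>(k + n) choose k \<le> 2 ^ (k + n)\<close>, the factorial of a sum is at most a product of factors in \<open>k\<close>
  and in \<open>n\<close>. Double series in \<open>c (k + n)\<close> thereby separate.
\<close>
lemma gevrey_add_bound:
  fixes c :: "nat \<Rightarrow> real"
  assumes "\<And>k. \<bar>c k\<bar> \<le> D * E ^ k * fact k powr \<sigma>" "0 \<le> D" "1 \<le> E" "0 \<le> \<sigma>" "\<sigma> \<le> 1"
  shows "\<bar>c (k + n)\<bar> \<le> D * ((2 * E) ^ n * fact n powr \<sigma>) * ((2 * E) ^ k * fact k powr \<sigma>)"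
proof -
  have "fact (k + n) = real ((k + n) choose k) * (fact k * fact n)"
  proof -
    have "fact k * fact n * ((k + n) choose k) = (fact (k + n) :: nat)"
      using binomial_fact_lemma[of k "k + n"] by simp
    hence "real (fact k * fact n * ((k + n) choose k)) = real (fact (k + n))"
      by (rule arg_cong)
    thus ?thesis by (simp add: mult_ac)
  qed
  also have "\<dots> \<le> 2 ^ (k + n) * (fact k * fact n)"
  proof -
    have "real ((k + n) choose k) \<le> real (2 ^ (k + n))"
      by (subst of_nat_le_iff) (rule binomial_le_pow2)
    thus ?thesis by (simp add: mult_right_mono)
  qed
  finally have "fact (k + n) powr \<sigma> \<le> ((2::real) ^ (k + n) * (fact k * fact n)) powr \<sigma>"
    using assms by (intro powr_mono2) auto
  also have "\<dots> = (2 ^ (k + n)) powr \<sigma> * (fact k powr \<sigma> * fact n powr \<sigma>)"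
    by (simp add: powr_mult)
  also have "\<dots> \<le> 2 ^ (k + n) * (fact k powr \<sigma> * fact n powr \<sigma>)"
  proof (rule mult_right_mono)
    have "(2 ^ (k + n)) powr \<sigma> \<le> (2 ^ (k + n)) powr (1::real)"
      using assms by (intro powr_mono) auto
    thus "(2 ^ (k + n)) powr \<sigma> \<le> (2 ^ (k + n) :: real)" by simp
  qed auto
  finally have "D * E ^ (k + n) * fact (k + n) powr \<sigma>
      \<le> D * E ^ (k + n) * (2 ^ (k + n) * (fact k powr \<sigma> * fact n powr \<sigma>))"
    using assms by (intro mult_left_mono) auto
  also have "\<dots> = D * ((2 * E) ^ n * fact n powr \<sigma>) * ((2 * E) ^ k * fact k powr \<sigma>)"
    by (simp add: power_add power_mult_distrib)
  finally show ?thesis using assms(1)[of "k + n"] by linarith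
qed

lemma gevrey_shift:
  assumes "gevrey \<sigma> c" "0 \<le> \<sigma>" "\<sigma> \<le> 1"
  shows "gevrey \<sigma> (\<lambda>k. c (k + n))"
proof -
  from assms(1) obtain D E where DE: "D \<ge> 0" "E \<ge> 1" "\<And>k. \<bar>c k\<bar> \<le> D * E ^ k * fact k powr \<sigma>"
    unfolding gevrey_def by blast
  show ?thesis
    unfolding gevrey_def
  proof (intro exI conjI allI)
    fix k show "\<bar>c (k + n)\<bar> \<le> (D * ((2 * E) ^ n * fact n powr \<sigma>)) * (2 * E) ^ k * fact k powr \<sigma>"
      using gevrey_add_bound[of c D E \<sigma> k n] DE assms by (simp add: mult_ac)
  qed (use DE in auto)
qed

text \<open>
  Fubini's theorem for the counting measure, where a bound that factorises replaces the convergence of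
  the double series by that of two simple ones.
\<close>
lemma suminf_swap_of_product_bound:
  fixes f :: "nat \<Rightarrow> nat \<Rightarrow> real"
  assumes f: "\<And>n k. \<bar>f n k\<bar> \<le> a n * b k" and a: "summable a" and b: "summable b"
  shows "summable (\<lambda>n. \<Sum>k. f n k)" "(\<Sum>n. \<Sum>k. f n k) = (\<Sum>k. \<Sum>n. f n k)"
proof -
  let ?M = "count_space (UNIV :: nat set)"
  have s1: "summable (\<lambda>n. norm (f n k))" for k
    by (rule summable_comparison_test'[OF summable_mult2[OF a, of "b k"]]) (use f in auto)
  have s2: "summable (\<lambda>k. norm (f n k))" for n
    by (rule summable_comparison_test'[OF summable_mult[OF b, of "a n"]]) (use f in auto)
  have int: "integrable ?M (\<lambda>n. f n k)" for k
    using s1 by (simp add: integrable_count_space_nat_iff)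
  have "\<bar>\<Sum>n. \<bar>f n k\<bar>\<bar> \<le> (\<Sum>n. a n) * b k" for k
  proof -
    have "(\<Sum>n. \<bar>f n k\<bar>) \<le> (\<Sum>n. a n * b k)"
      using s1 f by (intro suminf_le summable_mult2 a) auto
    also have "\<dots> = (\<Sum>n. a n) * b k" by (rule suminf_mult2[OF a, symmetric])
    finally show ?thesis using s1 by (subst abs_of_nonneg) (auto intro!: suminf_nonneg)
  qed
  hence s3: "summable (\<lambda>k. \<Sum>n. \<bar>f n k\<bar>)"
    by (intro summable_comparison_test'[OF summable_mult[OF b, of "\<Sum>n. a n"]]) auto
  have s4: "summable (\<lambda>k. \<integral>n. norm (f n k) \<partial>?M)"
    using s3 s1 by (subst integral_count_space_nat) (auto simp: integrable_count_space_nat_iff)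
  have "integrable ?M (\<lambda>n. \<Sum>k. f n k)"
    by (rule integrable_suminf[OF int _ s4]) (use s2 in auto)
  thus sum: "summable (\<lambda>n. \<Sum>k. f n k)"
    by (auto simp: integrable_count_space_nat_iff intro: summable_norm_cancel)
  have "(\<integral>n. (\<Sum>k. f n k) \<partial>?M) = (\<Sum>k. \<integral>n. f n k \<partial>?M)"
    by (rule integral_suminf[OF int _ s4]) (use s2 in auto)
  thus "(\<Sum>n. \<Sum>k. f n k) = (\<Sum>k. \<Sum>n. f n k)"
    using int \<open>integrable ?M (\<lambda>n. \<Sum>k. f n k)\<close> by (simp add: integral_count_space_nat)
qed

text \<open>
  After separation, \<open>1 / fact n\<close> leaves the weight \<open>fact n powr (\<sigma> - 1)\<close> in \<open>n\<close> and the Gamma factor leaves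
  \<open>fact k powr (\<sigma> - \<nu>)\<close> in \<open>k\<close>. Both exponents are negative.
\<close>
lemma gevrey_double_sum:
  assumes "gevrey \<sigma> c" "0 \<le> \<sigma>" "\<sigma> < \<nu>" "\<nu> < 1" "0 \<le> T"
  shows "summable (\<lambda>n. \<Sum>k. (-1) ^ n / fact n * (c (k + n) * T ^ k / Gamma (1 + real k * \<nu>)))"
    and "(\<Sum>n. \<Sum>k. (-1) ^ n / fact n * (c (k + n) * T ^ k / Gamma (1 + real k * \<nu>)))
       = (\<Sum>k. \<Sum>n. (-1) ^ n / fact n * (c (k + n) * T ^ k / Gamma (1 + real k * \<nu>)))"
proof -
  from assms(1) obtain D E where DE: "D \<ge> 0" "E \<ge> 1" "\<And>k. \<bar>c k\<bar> \<le> D * E ^ k * fact k powr \<sigma>"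
    unfolding gevrey_def by blast
  define a where "a n = D * ((2 * E) ^ n * fact n powr (-(1 - \<sigma>)))" for n
  define b where "b k = (2 * E) ^ k * fact k powr \<sigma> * T ^ k / Gamma (1 + real k * \<nu>)" for k
  have a: "summable a"
    unfolding a_def using assms DE by (intro summable_mult summable_power_times_fact_powr) auto
  have b: "summable b"
    unfolding b_def using assms DE by (intro summable_gevrey_bound) auto
  have bound: "\<bar>(-1) ^ n / fact n * (c (k + n) * T ^ k / Gamma (1 + real k * \<nu>))\<bar> \<le> a n * b k" for n k
  proof -
    have pos: "Gamma (1 + real k * \<nu>) > 0"
      using assms by (intro Gamma_real_pos add_pos_nonneg) auto
    have "\<bar>(-1) ^ n / fact n * (c (k + n) * T ^ k / Gamma (1 + real k * \<nu>))\<bar>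
        = \<bar>c (k + n)\<bar> * (T ^ k / Gamma (1 + real k * \<nu>) / fact n)"
      using pos assms by (simp add: abs_mult power_abs)
    also have "\<dots> \<le> D * ((2 * E) ^ n * fact n powr \<sigma>) * ((2 * E) ^ k * fact k powr \<sigma>) * (T ^ k / Gamma (1 + real k * \<nu>) / fact n)"
      using pos assms DE by (intro mult_right_mono gevrey_add_bound) auto
    also have "\<dots> = D * ((2 * E) ^ n * (fact n powr \<sigma> / fact n)) * b k"
      by (simp add: b_def mult_ac)
    also have "fact n powr \<sigma> / fact n = (fact n powr (-(1 - \<sigma>)) :: real)"
      by (simp add: powr_diff)
    finally show ?thesis by (simp add: a_def)
  qed
  show "summable (\<lambda>n. \<Sum>k. (-1) ^ n / fact n * (c (k + n) * T ^ k / Gamma (1 + real k * \<nu>)))"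
    "(\<Sum>n. \<Sum>k. (-1) ^ n / fact n * (c (k + n) * T ^ k / Gamma (1 + real k * \<nu>)))
       = (\<Sum>k. \<Sum>n. (-1) ^ n / fact n * (c (k + n) * T ^ k / Gamma (1 + real k * \<nu>)))"
    using suminf_swap_of_product_bound[OF bound a b] by blast+
qed

section \<open>Caputo derivatives of power series in a fractional power\<close>

text \<open>
  Euler's Beta integral under the substitution \<open>s = t * x\<close>.
\<close>
lemma has_bochner_integral_Beta_scaled:
  fixes a b t :: real
  assumes "0 < a" "0 < b" "0 < t"
  shows "has_bochner_integral lborel
           (\<lambda>s. indicator {0<..<t} s * (s powr (a - 1) * (t - s) powr (b - 1)))
           (t powr (a + b - 1) * Beta a b)"
proof -
  let ?f = "\<lambda>x::real. x powr (a - 1) * (1 - x) powr (b - 1)"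
  have Beta: "Beta a b \<ge> 0"
    using assms by (auto simp: Beta_def intro!: divide_nonneg_nonneg mult_nonneg_nonneg less_imp_le Gamma_real_pos)
  have "(?f has_integral Beta a b) {0<..<1}"
    using has_integral_Beta_real[OF assms(1,2)] by (simp add: has_integral_Icc_iff_Ioo)
  hence "integral\<^sup>N lborel (\<lambda>x. indicator {0<..<1} x * ?f x) = Beta a b"
    by (intro nn_integral_has_integral_lebesgue) auto
  hence unit: "has_bochner_integral lborel (\<lambda>x. indicator {0<..<1} x * ?f x) (Beta a b)"
    using Beta by (intro has_bochner_integral_nn_integral) auto
  have "has_bochner_integral lborel
         (\<lambda>x. t powr (a + b - 2) * (indicator {0<..<1} x * ?f x)) (t powr (a + b - 2) * Beta a b)"
    by (intro has_bochner_integral_mult_right unit)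
  moreover have "t powr (a + b - 2) * (indicator {0<..<1} x * ?f x) =
       indicator {0<..<t} (0 + t * x) * ((0 + t * x) powr (a - 1) * (t - (0 + t * x)) powr (b - 1))" for x
  proof (cases "x \<in> {0<..<1}")
    case True
    have "t - t * x = t * (1 - x)" by (simp add: algebra_simps)
    moreover have "t powr (a + b - 2) = t powr (a - 1) * t powr (b - 1)"
      by (simp flip: powr_add)
    ultimately show ?thesis using True assms by (simp add: powr_mult)
  next
    case False
    thus ?thesis using assms by (auto simp: indicator_def zero_less_mult_iff)
  qed
  moreover have "t powr (a + b - 2) * Beta a b = (t powr (a + b - 1) * Beta a b) /\<^sub>R \<bar>t\<bar>"
  proof -
    have "t powr (a + b - 1) = t powr (a + b - 2) * t powr 1"
      by (subst powr_add[symmetric]) simp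
    thus ?thesis using assms by (simp add: field_simps)
  qed
  ultimately show ?thesis
    using assms by (subst lborel_has_bochner_integral_real_affine_iff[where c = t and t = 0]) auto
qed

text \<open>
  The normalisation makes the Caputo derivative of order \<open>\<nu>\<close> act as the left shift of the coefficients,
  as ordinary differentiation does on exponential generating functions.
\<close>
definition frac_series :: "real \<Rightarrow> (nat \<Rightarrow> real) \<Rightarrow> real \<Rightarrow> real" where
  "frac_series \<nu> c t = (\<Sum>k. c k * (t powr \<nu>) ^ k / Gamma (1 + real k * \<nu>))"

text \<open>
  The right-hand side is what the chain rule gives for a power series in \<open>s powr \<nu>\<close>; on the left the
  Gamma factor is in the form that cancels against the Beta integral.
\<close>
lemma frac_series_deriv_term:
  fixes c :: "nat \<Rightarrow> real"
  assumes "0 < \<nu>" "0 < s"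
  shows "c (Suc k) / Gamma (real (Suc k) * \<nu>) * s powr (real (Suc k) * \<nu> - 1) =
         (diffs (\<lambda>k. c k / Gamma (1 + real k * \<nu>)) k * (s powr \<nu>) ^ k) * (\<nu> * s powr (\<nu> - 1))"
proof -
  have pos: "real (Suc k) * \<nu> > 0" using assms by simp
  hence "Gamma (1 + real (Suc k) * \<nu>) = real (Suc k) * \<nu> * Gamma (real (Suc k) * \<nu>)"
    by (subst add.commute, subst Gamma_plus1) auto
  hence "diffs (\<lambda>k. c k / Gamma (1 + real k * \<nu>)) k * \<nu> = c (Suc k) / Gamma (real (Suc k) * \<nu>)"
    using pos Gamma_real_pos[OF pos] assms by (simp add: diffs_def field_simps del: of_nat_Suc)
  moreover have "(s powr \<nu>) ^ k * s powr (\<nu> - 1) = s powr (real (Suc k) * \<nu> - 1)"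
    using assms by (simp add: powr_powr algebra_simps flip: powr_realpow powr_add)
  ultimately have "c (Suc k) / Gamma (real (Suc k) * \<nu>) * s powr (real (Suc k) * \<nu> - 1) =
      (diffs (\<lambda>k. c k / Gamma (1 + real k * \<nu>)) k * \<nu>) * ((s powr \<nu>) ^ k * s powr (\<nu> - 1))"
    by (simp only:)
  thus ?thesis by (simp only: mult_ac)
qed

lemma summable_gevrey_power:
  assumes "gevrey \<sigma> c" "\<sigma> < \<nu>" "0 < \<nu>"
  shows "summable (\<lambda>k. c k / Gamma (1 + real k * \<nu>) * y ^ k)"
proof (rule summable_comparison_test'[OF summable_gevrey[OF assms, of "\<bar>y\<bar>"]])
  fix k
  have "Gamma (1 + real k * \<nu>) > 0"
    using assms by (intro Gamma_real_pos add_pos_nonneg) auto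
  thus "norm (c k / Gamma (1 + real k * \<nu>) * y ^ k) \<le> \<bar>c k\<bar> * \<bar>y\<bar> ^ k / Gamma (1 + real k * \<nu>)"
    by (simp add: abs_mult power_abs)
qed auto

lemma gevrey_abs: "gevrey \<sigma> c \<Longrightarrow> gevrey \<sigma> (\<lambda>k. \<bar>c k\<bar>)"
  by (simp add: gevrey_def)

lemma summable_frac_series_deriv:
  assumes "gevrey \<sigma> c" "\<sigma> < \<nu>" "0 < \<nu>" "0 < s"
  shows "summable (\<lambda>k. c (Suc k) / Gamma (real (Suc k) * \<nu>) * s powr (real (Suc k) * \<nu> - 1))"
proof -
  have "summable (\<lambda>k. diffs (\<lambda>k. c k / Gamma (1 + real k * \<nu>)) k * (s powr \<nu>) ^ k)"
    by (rule termdiff_converges_all) (rule summable_gevrey_power[OF assms(1-3)])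
  thus ?thesis
    unfolding frac_series_deriv_term[OF assms(3,4)] by (rule summable_mult2)
qed

lemma has_real_derivative_frac_series:
  assumes "gevrey \<sigma> c" "\<sigma> < \<nu>" "0 < \<nu>" "0 < s"
  shows "(frac_series \<nu> c has_real_derivative
           (\<Sum>k. c (Suc k) / Gamma (real (Suc k) * \<nu>) * s powr (real (Suc k) * \<nu> - 1))) (at s)"
proof -
  define a where "a k = c k / Gamma (1 + real k * \<nu>)" for k
  have summ: "summable (\<lambda>k. a k * y ^ k)" for y
    unfolding a_def by (rule summable_gevrey_power[OF assms(1-3)])
  have 1: "((\<lambda>y. \<Sum>k. a k * y ^ k) has_real_derivative (\<Sum>k. diffs a k * (s powr \<nu>) ^ k)) (at (s powr \<nu>))"
    by (rule termdiffs_strong_converges_everywhere) (rule summ)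
  have 2: "((\<lambda>s. s powr \<nu>) has_real_derivative \<nu> * s powr (\<nu> - 1)) (at s)"
    using assms by (auto intro!: derivative_eq_intros)
  have "((\<lambda>s. \<Sum>k. a k * (s powr \<nu>) ^ k) has_real_derivative
          (\<Sum>k. diffs a k * (s powr \<nu>) ^ k) * (\<nu> * s powr (\<nu> - 1))) (at s)"
    by (rule DERIV_chain2[OF 1 2])
  also have "(\<lambda>s. \<Sum>k. a k * (s powr \<nu>) ^ k) = frac_series \<nu> c"
    by (simp add: frac_series_def a_def fun_eq_iff)
  also have "(\<Sum>k. diffs a k * (s powr \<nu>) ^ k) * (\<nu> * s powr (\<nu> - 1)) =
       (\<Sum>k. diffs a k * (s powr \<nu>) ^ k * (\<nu> * s powr (\<nu> - 1)))"
    by (rule suminf_mult2) (rule termdiff_converges_all, rule summ)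
  finally show ?thesis
    unfolding frac_series_deriv_term[OF assms(3,4)] a_def .
qed

text \<open>
  Differentiation and integration can be carried out term by term. The Beta integral maps
  \<open>s powr ((k + 1) * \<nu> - 1)\<close> to a multiple of \<open>t powr (k * \<nu>)\<close>, and the Gamma factors combine to the
  normalisation of the series; the constant term is lost under the derivative. Only the values of \<open>u\<close>
  at positive times are constrained, as needed for iterating: the Caputo derivatives agree with the
  series only there.
\<close>
lemma caputo_frac_series:
  assumes c: "gevrey \<sigma> c" and \<sigma>: "0 \<le> \<sigma>" "\<sigma> < \<nu>" and \<nu>: "0 < \<nu>" "\<nu> < 1"
    and u: "\<And>s. 0 < s \<Longrightarrow> u s = frac_series \<nu> c s" and t: "0 < t"
  shows "caputo_differentiable \<nu> u t" "caputo \<nu> u t = frac_series \<nu> (\<lambda>k. c (Suc k)) t"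
proof -
  define d where "d s = (\<Sum>k. c (Suc k) / Gamma (real (Suc k) * \<nu>) * s powr (real (Suc k) * \<nu> - 1))" for s
  have du: "(u has_real_derivative d s) (at s)" if s: "0 < s" for s
    using has_real_derivative_frac_series[OF c \<sigma>(2) \<nu>(1) s] unfolding d_def
    by (rule has_field_derivative_transform_within_open[of _ _ _ "{0<..}"]) (use s u in auto)
  define f where "f k s = indicator {0<..<t} s *
     (c (Suc k) / Gamma (real (Suc k) * \<nu>) * s powr (real (Suc k) * \<nu> - 1) * (t - s) powr (-\<nu>))" for k s
  have int_gen: "has_bochner_integral lborel (\<lambda>s. indicator {0<..<t} s *
       (c' / Gamma (real (Suc k) * \<nu>) * s powr (real (Suc k) * \<nu> - 1) * (t - s) powr (-\<nu>)))
       (Gamma (1 - \<nu>) * (c' * (t powr \<nu>) ^ k / Gamma (1 + real k * \<nu>)))" for k c'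
  proof -
    define p where "p = real (Suc k) * \<nu>"
    have p: "0 < p" "p + (1 - \<nu>) = 1 + real k * \<nu>" "p + (1 - \<nu>) - 1 = real k * \<nu>"
      using \<nu> by (simp add: p_def) (simp_all add: p_def algebra_simps)
    have "has_bochner_integral lborel (\<lambda>s. (c' / Gamma p) * (indicator {0<..<t} s *
       (s powr (p - 1) * (t - s) powr ((1 - \<nu>) - 1))))
       (c' / Gamma p * (t powr (p + (1 - \<nu>) - 1) * Beta p (1 - \<nu>)))"
      by (intro has_bochner_integral_mult_right has_bochner_integral_Beta_scaled) (use \<nu> t p in auto)
    moreover have "c' / Gamma p * (t powr (p + (1 - \<nu>) - 1) * Beta p (1 - \<nu>)) =
        Gamma (1 - \<nu>) * (c' * (t powr \<nu>) ^ k / Gamma (1 + real k * \<nu>))"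
    proof -
      have "t powr (real k * \<nu>) = (t powr \<nu>) ^ k"
        using t by (simp add: powr_powr mult.commute flip: powr_realpow)
      moreover have "Gamma p > 0" using p by (intro Gamma_real_pos) auto
      ultimately show ?thesis
        unfolding Beta_def p(2,3) by simp
    qed
    ultimately show ?thesis
      unfolding p_def[symmetric] by (simp add: mult_ac)
  qed
  have int: "has_bochner_integral lborel (f k)
       (Gamma (1 - \<nu>) * (c (Suc k) * (t powr \<nu>) ^ k / Gamma (1 + real k * \<nu>)))" for k
    using int_gen[of "c (Suc k)" k] unfolding f_def .
  have int_norm: "has_bochner_integral lborel (\<lambda>s. norm (f k s))
       (Gamma (1 - \<nu>) * (\<bar>c (Suc k)\<bar> * (t powr \<nu>) ^ k / Gamma (1 + real k * \<nu>)))" for k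
  proof -
    have "Gamma (real (Suc k) * \<nu>) > 0"
      using \<nu> by (intro Gamma_real_pos) auto
    hence "norm (f k s) = indicator {0<..<t} s *
       (\<bar>c (Suc k)\<bar> / Gamma (real (Suc k) * \<nu>) * s powr (real (Suc k) * \<nu> - 1) * (t - s) powr (-\<nu>))" for s
      by (simp add: f_def abs_mult)
    thus ?thesis using int_gen[of "\<bar>c (Suc k)\<bar>" k] by (simp del: of_nat_Suc)
  qed
  have summ1: "summable (\<lambda>k. norm (f k s))" for s
  proof (cases "s \<in> {0<..<t}")
    case True
    have "summable (\<lambda>k. \<bar>c (Suc k)\<bar> / Gamma (real (Suc k) * \<nu>) * s powr (real (Suc k) * \<nu> - 1))"
      using summable_frac_series_deriv[OF gevrey_abs[OF c] \<sigma>(2) \<nu>(1)] True by auto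
    hence "summable (\<lambda>k. \<bar>c (Suc k)\<bar> / Gamma (real (Suc k) * \<nu>) * s powr (real (Suc k) * \<nu> - 1) * (t - s) powr (-\<nu>))"
      by (rule summable_mult2)
    moreover have "\<bar>Gamma (real (Suc k) * \<nu>)\<bar> = Gamma (real (Suc k) * \<nu>)" for k
      using \<nu> by (intro abs_of_pos Gamma_real_pos) auto
    ultimately show ?thesis
      using True by (simp add: f_def abs_mult del: of_nat_Suc)
  qed (simp add: f_def)
  have c1: "gevrey \<sigma> (\<lambda>k. c (Suc k))"
    using gevrey_shift[OF c, of 1] \<sigma> \<nu> by simp
  have summ2: "summable (\<lambda>k. \<integral>s. norm (f k s) \<partial>lborel)"
    unfolding has_bochner_integral_integral_eq[OF int_norm]
    by (intro summable_mult summable_gevrey[OF c1]) (use \<sigma> \<nu> in auto)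
  have sum_f: "(\<Sum>k. f k s) = indicator {0<..<t} s *\<^sub>R ((t - s) powr (-\<nu>) * deriv u s)" for s
  proof (cases "s \<in> {0<..<t}")
    case True
    have "(\<Sum>k. f k s) = d s * (t - s) powr (-\<nu>)"
      unfolding d_def using True summable_frac_series_deriv[OF c \<sigma>(2) \<nu>(1), of s]
      by (subst suminf_mult2) (auto simp: f_def)
    also have "d s = deriv u s"
      using DERIV_imp_deriv[OF du, of s] True by simp
    finally show ?thesis using True by simp
  qed (simp add: f_def)
  have "integrable lborel (\<lambda>s. \<Sum>k. f k s)"
    by (rule integrable_suminf[OF _ _ summ2]) (use int summ1 in \<open>auto simp: has_bochner_integral_iff\<close>)
  hence "set_integrable lborel {0<..<t} (\<lambda>s. (t - s) powr (-\<nu>) * deriv u s)"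
    unfolding sum_f set_integrable_def .
  thus "caputo_differentiable \<nu> u t"
    unfolding caputo_differentiable_def using du unfolding real_differentiable_def
    by (meson greaterThanLessThan_iff)
  have "(\<integral>s. (\<Sum>k. f k s) \<partial>lborel) = (\<Sum>k. integral\<^sup>L lborel (f k))"
    by (rule integral_suminf[OF _ _ summ2]) (use int summ1 in \<open>auto simp: has_bochner_integral_iff\<close>)
  also have "\<dots> = (\<Sum>k. Gamma (1 - \<nu>) * (c (Suc k) * (t powr \<nu>) ^ k / Gamma (1 + real k * \<nu>)))"
    by (simp only: has_bochner_integral_integral_eq[OF int])
  also have "\<dots> = Gamma (1 - \<nu>) * frac_series \<nu> (\<lambda>k. c (Suc k)) t"
    unfolding frac_series_def
    by (rule suminf_mult) (use summable_gevrey_power[OF c1 \<sigma>(2) \<nu>(1), of "t powr \<nu>"] in simp)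
  finally have "(LBINT s:{0<..<t}. (t - s) powr (- \<nu>) * deriv u s) = Gamma (1 - \<nu>) * frac_series \<nu> (\<lambda>k. c (Suc k)) t"
    unfolding sum_f set_lebesgue_integral_def .
  moreover have "Gamma (1 - \<nu>) > 0" using \<nu> by (intro Gamma_real_pos) auto
  ultimately show "caputo \<nu> u t = frac_series \<nu> (\<lambda>k. c (Suc k)) t"
    unfolding caputo_def by simp
qed

lemma caputo_funpow_frac_series:
  assumes c: "gevrey \<sigma> c" and \<sigma>: "0 \<le> \<sigma>" "\<sigma> < \<nu>" and \<nu>: "0 < \<nu>" "\<nu> < 1"
    and u: "\<And>s. 0 < s \<Longrightarrow> u s = frac_series \<nu> c s" and t: "0 < t"
  shows "(caputo \<nu> ^^ n) u t = frac_series \<nu> (\<lambda>k. c (k + n)) t"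
  using t
proof (induction n arbitrary: t)
  case (Suc n)
  have "gevrey \<sigma> (\<lambda>k. c (k + n))"
    using gevrey_shift[OF c] \<sigma> \<nu> by simp
  hence "caputo \<nu> ((caputo \<nu> ^^ n) u) t = frac_series \<nu> (\<lambda>k. c (Suc k + n)) t"
    by (rule caputo_frac_series(2)[OF _ \<sigma> \<nu>]) (use Suc in auto)
  thus ?case by simp
qed (simp add: u)

text \<open>
  The \<open>n\<close>-th iterated derivative has coefficients \<open>c (k + n)\<close>; exchanging the two summations turns the
  fractional shift into an ordinary shift by \<open>-1\<close> performed on the Taylor coefficients \<open>c\<close>.
\<close>
lemma frac_shift_frac_series:
  assumes c: "gevrey \<sigma> c" and \<sigma>: "0 \<le> \<sigma>" "\<sigma> < \<nu>" and \<nu>: "0 < \<nu>" "\<nu> < 1"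
    and u: "\<And>s. 0 < s \<Longrightarrow> u s = frac_series \<nu> c s" and t: "0 < t"
  shows "frac_shift_exists \<nu> (-1) u t"
    and "frac_shift \<nu> (-1) u t = frac_series \<nu> (\<lambda>k. \<Sum>n. (-1) ^ n / fact n * c (k + n)) t"
proof -
  have caputo_n: "(caputo \<nu> ^^ n) u s = frac_series \<nu> (\<lambda>k. c (k + n)) s" if "0 < s" for n s
    by (rule caputo_funpow_frac_series[OF c \<sigma> \<nu>]) (use u that in auto)
  have cn: "gevrey \<sigma> (\<lambda>k. c (k + n))" for n
    using gevrey_shift[OF c] \<sigma> \<nu> by simp
  have summ_n: "summable (\<lambda>k. c (k + n) * (t powr \<nu>) ^ k / Gamma (1 + real k * \<nu>))" for n
    using summable_gevrey_power[OF cn \<sigma>(2) \<nu>(1), of _ "t powr \<nu>"] by simp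
  have eq: "(-1) ^ n / fact n * (caputo \<nu> ^^ n) u t =
       (\<Sum>k. (-1) ^ n / fact n * (c (k + n) * (t powr \<nu>) ^ k / Gamma (1 + real k * \<nu>)))" for n
    unfolding caputo_n[OF t] frac_series_def by (rule suminf_mult[symmetric, OF summ_n])
  have "caputo_differentiable \<nu> ((caputo \<nu> ^^ n) u) s" if "0 < s" for n s
    by (rule caputo_frac_series(1)[OF cn \<sigma> \<nu>]) (use caputo_n that in auto)
  thus "frac_shift_exists \<nu> (-1) u t"
    unfolding frac_shift_exists_def eq
    using gevrey_double_sum(1)[OF c \<sigma> \<nu>(2), of "t powr \<nu>"] by simp
  have summ_k: "summable (\<lambda>n. (-1) ^ n / fact n * c (k + n))" for k
  proof -
    from c obtain D E where DE: "D \<ge> 0" "E \<ge> 1" "\<And>k. \<bar>c k\<bar> \<le> D * E ^ k * fact k powr \<sigma>"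
      unfolding gevrey_def by blast
    define K where "K = D * ((2 * E) ^ k * fact k powr \<sigma>)"
    show ?thesis
    proof (rule summable_comparison_test')
      show "summable (\<lambda>n. K * ((2 * E) ^ n * fact n powr (-(1 - \<sigma>))))"
        using \<sigma> \<nu> DE by (intro summable_mult summable_power_times_fact_powr) auto
      fix n
      have "norm ((-1) ^ n / fact n * c (k + n)) = \<bar>c (k + n)\<bar> / fact n"
        by (simp add: abs_mult power_abs)
      also have "\<dots> \<le> D * ((2 * E) ^ n * fact n powr \<sigma>) * ((2 * E) ^ k * fact k powr \<sigma>) / fact n"
        using DE \<sigma> \<nu> by (intro divide_right_mono gevrey_add_bound) auto
      also have "\<dots> = K * ((2 * E) ^ n * (fact n powr \<sigma> / fact n))"
        by (simp add: K_def mult_ac)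
      also have "fact n powr \<sigma> / fact n = (fact n powr (-(1 - \<sigma>)) :: real)"
        by (simp add: powr_diff)
      finally show "norm ((-1) ^ n / fact n * c (k + n)) \<le> K * ((2 * E) ^ n * fact n powr (-(1 - \<sigma>)))" .
    qed
  qed
  have "frac_shift \<nu> (-1) u t =
     (\<Sum>k. \<Sum>n. (-1) ^ n / fact n * (c (k + n) * (t powr \<nu>) ^ k / Gamma (1 + real k * \<nu>)))"
    unfolding frac_shift_def eq using gevrey_double_sum(2)[OF c \<sigma> \<nu>(2), of "t powr \<nu>"] by simp
  also have "\<dots> = frac_series \<nu> (\<lambda>k. \<Sum>n. (-1) ^ n / fact n * c (k + n)) t"
    unfolding frac_series_def
  proof (rule suminf_cong)
    fix k
    have "(\<Sum>n. (-1) ^ n / fact n * c (k + n)) * ((t powr \<nu>) ^ k / Gamma (1 + real k * \<nu>))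
       = (\<Sum>n. (-1) ^ n / fact n * c (k + n) * ((t powr \<nu>) ^ k / Gamma (1 + real k * \<nu>)))"
      by (rule suminf_mult2[OF summ_k])
    thus "(\<Sum>n. (-1) ^ n / fact n * (c (k + n) * (t powr \<nu>) ^ k / Gamma (1 + real k * \<nu>))) =
      (\<Sum>n. (-1) ^ n / fact n * c (k + n)) * (t powr \<nu>) ^ k / Gamma (1 + real k * \<nu>)"
      by (simp add: mult.assoc)
  qed
  finally show "frac_shift \<nu> (-1) u t = frac_series \<nu> (\<lambda>k. \<Sum>n. (-1) ^ n / fact n * c (k + n)) t" .
qed

section \<open>Laplace transforms and Gamma integrals\<close>

text \<open>
  For a bounded variable the characteristic function is the sum of its moment series, so equal moments
  give equal characteristic functions, and Levy's uniqueness theorem applies.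
\<close>
lemma (in prob_space) distr_eq_if_moments_eq:
  fixes X Y :: "'a \<Rightarrow> real"
  assumes [measurable]: "random_variable borel X" "random_variable borel Y"
    and X: "AE \<omega> in M. 0 \<le> X \<omega> \<and> X \<omega> \<le> 1" and Y: "AE \<omega> in M. 0 \<le> Y \<omega> \<and> Y \<omega> \<le> 1"
    and eq: "\<And>k. expectation (\<lambda>\<omega>. X \<omega> ^ k) = expectation (\<lambda>\<omega>. Y \<omega> ^ k)"
  shows "distr M borel X = distr M borel Y"
proof (rule Levy_uniqueness)
  have char_lim: "(\<lambda>n. \<Sum>k\<le>n. ((\<i> * t) ^ k / fact k) * complex_of_real (expectation (\<lambda>\<omega>. Z \<omega> ^ k))) \<longlonglongrightarrow> char (distr M borel Z) t"
    if [measurable]: "random_variable borel Z" and Z: "AE \<omega> in M. 0 \<le> Z \<omega> \<and> Z \<omega> \<le> 1" for Z t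
  proof -
    have int: "integrable M (\<lambda>\<omega>. Z \<omega> ^ k)" for k
    proof (rule integrable_const_bound[where B = 1])
      show "AE \<omega> in M. norm (Z \<omega> ^ k) \<le> 1"
        using Z by eventually_elim (simp add: power_abs power_le_one)
    qed simp
    have bound: "norm (char (distr M borel Z) t - (\<Sum>k\<le>n. ((\<i> * t) ^ k / fact k) * complex_of_real (expectation (\<lambda>\<omega>. Z \<omega> ^ k))))
        \<le> 2 * (\<bar>t\<bar> ^ n / fact n)" for n
    proof -
      have "norm (char (distr M borel Z) t - (\<Sum>k\<le>n. ((\<i> * t) ^ k / fact k) * complex_of_real (expectation (\<lambda>\<omega>. Z \<omega> ^ k))))
        \<le> (2 * \<bar>t\<bar> ^ n / fact n) * expectation (\<lambda>\<omega>. \<bar>Z \<omega>\<bar> ^ n)"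
        by (rule char_approx1'[OF int]) auto
      also have "\<dots> \<le> (2 * \<bar>t\<bar> ^ n / fact n) * expectation (\<lambda>\<omega>. 1)"
      proof (intro mult_left_mono integral_mono_AE)
        show "integrable M (\<lambda>\<omega>. \<bar>Z \<omega>\<bar> ^ n)"
          using integrable_abs[OF int[of n]] by (simp add: power_abs)
        show "AE \<omega> in M. \<bar>Z \<omega>\<bar> ^ n \<le> 1"
          using Z by eventually_elim (simp add: power_le_one)
      qed simp_all
      finally show ?thesis by (simp add: prob_space)
    qed
    have lim: "(\<lambda>n. 2 * (\<bar>t\<bar> ^ n / fact n)) \<longlonglongrightarrow> 2 * 0"
      using summable_LIMSEQ_zero[OF summable_exp[of "\<bar>t\<bar>"]]
      by (intro tendsto_mult tendsto_const) (simp add: field_simps)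
    have "(\<lambda>n. char (distr M borel Z) t - (\<Sum>k\<le>n. ((\<i> * t) ^ k / fact k) * complex_of_real (expectation (\<lambda>\<omega>. Z \<omega> ^ k)))) \<longlonglongrightarrow> 0"
      by (rule Lim_null_comparison[OF always_eventually[OF allI[OF bound]]]) (use lim in simp)
    from tendsto_diff[OF tendsto_const[of "char (distr M borel Z) t"] this] show ?thesis
      by simp
  qed
  show "char (distr M borel X) = char (distr M borel Y)"
  proof
    fix t
    show "char (distr M borel X) t = char (distr M borel Y) t"
      using char_lim[OF _ X, of t] char_lim[OF _ Y, of t] eq by (auto intro: LIMSEQ_unique)
  qed
qed auto

text \<open>
  The values of the Laplace transform at the natural numbers are the moments of \<open>exp (- X)\<close>, which lies
  in the unit interval and determines \<open>X\<close>.
\<close>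
lemma (in prob_space) distr_eq_if_Laplace_eq:
  fixes X Y :: "'a \<Rightarrow> real"
  assumes [measurable]: "random_variable borel X" "random_variable borel Y"
    and X: "AE \<omega> in M. 0 \<le> X \<omega>" and Y: "AE \<omega> in M. 0 \<le> Y \<omega>"
    and eq: "\<And>k. 0 < k \<Longrightarrow> expectation (\<lambda>\<omega>. exp (- real k * X \<omega>)) = expectation (\<lambda>\<omega>. exp (- real k * Y \<omega>))"
  shows "distr M borel X = distr M borel Y"
proof -
  have pow: "exp (- x) ^ k = exp (- real k * x)" for x :: real and k
    by (simp flip: exp_of_nat_mult)
  have "distr M borel (\<lambda>\<omega>. exp (- X \<omega>)) = distr M borel (\<lambda>\<omega>. exp (- Y \<omega>))"
  proof (rule distr_eq_if_moments_eq)
    fix k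
    show "expectation (\<lambda>\<omega>. exp (- X \<omega>) ^ k) = expectation (\<lambda>\<omega>. exp (- Y \<omega>) ^ k)"
      unfolding pow using eq[of k] by (cases "k = 0") auto
  qed (use X Y in auto)
  \<comment> \<open>recover the variables by the measurable inverse of \<open>exp (- x)\<close>\<close>
  hence "distr (distr M borel (\<lambda>\<omega>. exp (- X \<omega>))) borel (\<lambda>x. - ln x) = distr (distr M borel (\<lambda>\<omega>. exp (- Y \<omega>))) borel (\<lambda>x. - ln x)"
    by simp
  thus ?thesis
    by (simp add: distr_distr o_def)
qed

text \<open>
  The substitution \<open>u = a * s powr \<alpha>\<close> in Euler's integral. The case \<open>\<alpha> = 1\<close> expresses a negative power
  of \<open>a\<close> as a mixture of exponentials; the case \<open>a = 1\<close>, \<open>\<alpha> = \<nu>\<close> evaluates the resulting integral of a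
  stable Laplace transform.
\<close>
lemma nn_integral_powr_exp_powr:
  fixes \<alpha> a p :: real
  assumes "0 < \<alpha>" "0 < a" "0 < p"
  shows "(\<integral>\<^sup>+s. ennreal (indicator {0<..} s * (s powr (\<alpha> * p - 1) * exp (- (a * s powr \<alpha>)))) \<partial>lborel)
       = ennreal (Gamma p / (\<alpha> * a powr p))"
proof -
  define f where "f u = u powr (p - 1) / exp u" for u :: real
  define g where "g s = a * s powr \<alpha>" for s
  define g' where "g' s = a * (\<alpha> * s powr (\<alpha> - 1))" for s
  have img: "g ` {0<..} = {0<..}"
  proof (intro equalityI subsetI)
    fix y :: real assume y: "y \<in> {0<..}"
    have "g ((y / a) powr (1 / \<alpha>)) = y" "(y / a) powr (1 / \<alpha>) \<in> {0<..}"
      using y assms by (auto simp: g_def powr_powr)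
    thus "y \<in> g ` {0<..}" by (metis image_eqI)
  qed (use assms in \<open>auto simp: g_def\<close>)
  have "(f has_integral Gamma p) {0..}"
    unfolding f_def by (rule Gamma_integral_real[OF assms(3)])
  hence F: "(f has_integral Gamma p) {0<..}"
    by (subst (asm) has_integral_spike_set_eq[of _ "{0<..}"]) (auto intro: negligible_subset[of "{0}"])
  have *: "f absolutely_integrable_on g ` {0<..} \<and> integral (g ` {0<..}) f = Gamma p"
    unfolding img using F
    by (auto intro!: nonnegative_absolutely_integrable_1 simp: f_def has_integral_integrable_integral)
  have "(\<lambda>x. \<bar>g' x\<bar> * f (g x)) absolutely_integrable_on {0<..} \<and>
      integral {0<..} (\<lambda>x. \<bar>g' x\<bar> * f (g x)) = Gamma p"
  proof -
    have "(g has_field_derivative g' x) (at x within {0<..})" if "x \<in> {0<..}" for x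
      unfolding g_def g'_def using that by (auto intro!: derivative_eq_intros)
    moreover have "inj_on g {0<..}"
    proof (rule inj_onI)
      fix x y assume xy: "x \<in> {0<..}" "y \<in> {0<..}" "g x = g y"
      hence "(x powr \<alpha>) powr (1 / \<alpha>) = (y powr \<alpha>) powr (1 / \<alpha>)"
        using assms by (simp add: g_def)
      thus "x = y" using xy assms by (simp add: powr_powr)
    qed
    ultimately show ?thesis
      using has_absolute_integral_change_of_variables_1'[of "{0<..}" g g' f "Gamma p"] *
      by auto
  qed
  hence "((\<lambda>x. \<bar>g' x\<bar> * f (g x)) has_integral Gamma p) {0<..}"
    by (auto simp: has_integral_integrable_integral absolutely_integrable_on_def)
  hence "((\<lambda>x. (1 / (\<alpha> * a powr p)) * (\<bar>g' x\<bar> * f (g x))) has_integral (1 / (\<alpha> * a powr p)) * Gamma p) {0<..}"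
    by (rule has_integral_mult_right)
  hence "((\<lambda>s. s powr (\<alpha> * p - 1) * exp (- (a * s powr \<alpha>))) has_integral (1 / (\<alpha> * a powr p)) * Gamma p) {0<..}"
  proof (rule has_integral_eq[rotated])
    fix s :: real assume s: "s \<in> {0<..}"
    have "\<bar>g' s\<bar> * f (g s) = (a * a powr (p - 1)) * \<alpha> * (s powr (\<alpha> - 1) * (s powr \<alpha>) powr (p - 1)) * exp (- (a * s powr \<alpha>))"
      using s assms by (simp add: g'_def f_def g_def powr_mult exp_minus field_simps)
    also have "a * a powr (p - 1) = a powr p"
      using assms by (simp add: powr_mult_base)
    also have "s powr (\<alpha> - 1) * (s powr \<alpha>) powr (p - 1) = s powr (\<alpha> * p - 1)"
      by (simp add: powr_powr algebra_simps flip: powr_add)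
    finally show "(1 / (\<alpha> * a powr p)) * (\<bar>g' s\<bar> * f (g s)) = s powr (\<alpha> * p - 1) * exp (- (a * s powr \<alpha>))"
      using assms by simp
  qed
  thus ?thesis
    using nn_integral_has_integral_lebesgue[of "{0<..}" "\<lambda>s. s powr (\<alpha> * p - 1) * exp (- (a * s powr \<alpha>))"]
    by (simp add: field_simps)
qed

section \<open>The stable subordinator and its inverse\<close>

lemma stable_subordinatorD:
  assumes "stable_subordinator M \<nu> A"
  shows "prob_space M" "\<And>z. 0 \<le> z \<Longrightarrow> A z \<in> borel_measurable M"
    "AE \<omega> in M. A 0 \<omega> = 0 \<and> mono_on {0..} (\<lambda>z. A z \<omega>)"
    "\<And>z k. 0 \<le> z \<Longrightarrow> 0 < k \<Longrightarrow> integral\<^sup>L M (\<lambda>\<omega>. exp (- k * A z \<omega>)) = exp (- (k powr \<nu>) * z)"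
  using assms unfolding stable_subordinator_def subordinator_def by auto

lemma stable_subordinator_nonneg:
  assumes "stable_subordinator M \<nu> A" "0 \<le> z"
  shows "AE \<omega> in M. 0 \<le> A z \<omega>"
  using stable_subordinatorD(3)[OF assms(1)]
proof eventually_elim
  case (elim \<omega>)
  thus ?case using assms(2) mono_onD[of "{0..}" "\<lambda>z. A z \<omega>" 0 z] by auto
qed

lemma stable_subordinator_integrable_exp:
  assumes "stable_subordinator M \<nu> A" "0 \<le> z" "0 \<le> k"
  shows "integrable M (\<lambda>\<omega>. exp (- k * A z \<omega>))"
proof -
  interpret prob_space M by (rule stable_subordinatorD(1)[OF assms(1)])
  have [measurable]: "A z \<in> borel_measurable M"
    by (rule stable_subordinatorD(2)[OF assms(1,2)])
  show ?thesis
  proof (rule integrable_const_bound[where B = 1])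
    show "AE \<omega> in M. norm (exp (- k * A z \<omega>)) \<le> 1"
      using stable_subordinator_nonneg[OF assms(1,2)] by eventually_elim (use assms in auto)
  qed measurable
qed

text \<open>
  Both sides have the Laplace transform \<open>exp (- (k powr \<nu>) * z)\<close>.
\<close>
lemma stable_subordinator_self_similar:
  assumes A: "stable_subordinator M \<nu> A" and "0 < \<nu>" "0 < z"
  shows "distr M borel (A z) = distr M borel (\<lambda>\<omega>. z powr (1 / \<nu>) * A 1 \<omega>)"
proof -
  interpret prob_space M by (rule stable_subordinatorD(1)[OF A])
  have [measurable]: "A z \<in> borel_measurable M" "A 1 \<in> borel_measurable M"
    using stable_subordinatorD(2)[OF A] assms by auto
  show ?thesis
  proof (rule distr_eq_if_Laplace_eq)
    show "AE \<omega> in M. 0 \<le> A z \<omega>"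
      using stable_subordinator_nonneg[OF A] assms by simp
    show "AE \<omega> in M. 0 \<le> z powr (1 / \<nu>) * A 1 \<omega>"
      using stable_subordinator_nonneg[OF A zero_le_one] by eventually_elim simp
    fix k :: nat assume k: "0 < k"
    have "expectation (\<lambda>\<omega>. exp (- (real k * z powr (1 / \<nu>)) * A 1 \<omega>)) = exp (- ((real k * z powr (1 / \<nu>)) powr \<nu>) * 1)"
      using k assms by (intro stable_subordinatorD(4)[OF A]) auto
    also have "(real k * z powr (1 / \<nu>)) powr \<nu> = real k powr \<nu> * z"
      using assms by (simp add: powr_mult powr_powr)
    finally show "expectation (\<lambda>\<omega>. exp (- real k * A z \<omega>)) =
        expectation (\<lambda>\<omega>. exp (- real k * (z powr (1 / \<nu>) * A 1 \<omega>)))"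
      using stable_subordinatorD(4)[OF A, of z k] k assms by (simp add: mult_ac)
  qed auto
qed

text \<open>
  The exponential Markov inequality. Large \<open>k\<close> yields positivity of the process, large \<open>z\<close> its unboundedness.
\<close>
lemma stable_subordinator_prob_le:
  assumes A: "stable_subordinator M \<nu> A" and "0 \<le> z" "0 < k"
  shows "measure M {\<omega> \<in> space M. A z \<omega> \<le> a} \<le> exp (k * a - k powr \<nu> * z)"
proof -
  interpret prob_space M by (rule stable_subordinatorD(1)[OF A])
  have [measurable]: "A z \<in> borel_measurable M"
    using stable_subordinatorD(2)[OF A] assms by auto
  have "prob {\<omega> \<in> space M. A z \<omega> \<le> a} \<le> prob {\<omega> \<in> space M. exp (- k * a) \<le> exp (- k * A z \<omega>)}"
    using assms by (intro finite_measure_mono) auto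
  also have "\<dots> \<le> expectation (\<lambda>\<omega>. exp (- k * A z \<omega>)) / exp (- k * a)"
    using assms by (intro integral_Markov_inequality_measure[where A = "{}"] stable_subordinator_integrable_exp[OF A]) auto
  also have "\<dots> = exp (k * a - k powr \<nu> * z)"
    using assms by (subst stable_subordinatorD(4)[OF A]) (auto simp: exp_diff exp_minus field_simps)
  finally show ?thesis .
qed

lemma stable_subordinator_pos:
  assumes A: "stable_subordinator M \<nu> A" and "0 < \<nu>" "0 < z"
  shows "AE \<omega> in M. 0 < A z \<omega>"
proof -
  interpret prob_space M by (rule stable_subordinatorD(1)[OF A])
  have [measurable]: "A z \<in> borel_measurable M"
    using stable_subordinatorD(2)[OF A] assms by auto
  have "(\<lambda>k. exp (- (real (Suc k) powr \<nu> * z))) \<longlonglongrightarrow> 0"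
    using assms by real_asymp
  hence "prob {\<omega> \<in> space M. A z \<omega> \<le> 0} \<le> 0"
    using stable_subordinator_prob_le[OF A, of z _ 0] assms
    by (intro LIMSEQ_le_const) (auto simp del: of_nat_Suc)
  hence "prob {\<omega> \<in> space M. A z \<omega> \<le> 0} = 0"
    by (simp add: measure_le_0_iff)
  hence "AE \<omega> in M. \<not> A z \<omega> \<le> 0"
    by (subst (asm) prob_eq_0) (auto elim: eventually_mono)
  thus ?thesis by eventually_elim auto
qed

text \<open>
  This makes the set in the definition of the inverse process nonempty almost surely, so that its
  infimum has the expected meaning.
\<close>
lemma stable_subordinator_unbounded:
  assumes A: "stable_subordinator M \<nu> A"
  shows "AE \<omega> in M. \<exists>z\<ge>0. t < A z \<omega>"
proof -
  interpret prob_space M by (rule stable_subordinatorD(1)[OF A])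
  have [measurable]: "A (real n) \<in> borel_measurable M" for n
    using stable_subordinatorD(2)[OF A] by auto
  have "prob {\<omega> \<in> space M. \<forall>n. A (real n) \<omega> \<le> t} \<le> exp (t - real n)" for n
  proof -
    have "prob {\<omega> \<in> space M. \<forall>n. A (real n) \<omega> \<le> t} \<le> prob {\<omega> \<in> space M. A (real n) \<omega> \<le> t}"
      by (intro finite_measure_mono) auto
    also have "\<dots> \<le> exp (t - real n)"
      using stable_subordinator_prob_le[OF A, of n 1 t] by simp
    finally show ?thesis .
  qed
  moreover have "(\<lambda>n. exp (t - real n)) \<longlonglongrightarrow> 0"
    by real_asymp
  ultimately have "prob {\<omega> \<in> space M. \<forall>n. A (real n) \<omega> \<le> t} \<le> 0"
    by (intro LIMSEQ_le_const) auto
  hence "prob {\<omega> \<in> space M. \<forall>n. A (real n) \<omega> \<le> t} = 0"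
    by (simp add: measure_le_0_iff)
  hence "AE \<omega> in M. \<not> (\<forall>n. A (real n) \<omega> \<le> t)"
    by (subst (asm) prob_eq_0) (auto elim: eventually_mono)
  thus ?thesis
    by eventually_elim (metis not_le of_nat_0_le_iff)
qed

lemma AE_neq_if_distributed_lborel:
  fixes X :: "'a \<Rightarrow> real"
  assumes "distributed M lborel X g"
  shows "AE \<omega> in M. X \<omega> \<noteq> z"
proof -
  have [measurable]: "g \<in> borel_measurable lborel" "X \<in> M \<rightarrow>\<^sub>M lborel"
    and distr: "distr M lborel X = density lborel g"
    using assms by (auto simp: distributed_def)
  have "AE x in density lborel g. x \<noteq> z"
    using AE_lborel_singleton[of z] by (subst AE_density) auto
  thus ?thesis
    unfolding distr[symmetric] using assms
    by (subst (asm) AE_distr_iff) (auto simp: distributed_def)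
qed

text \<open>
  By monotonicity of the paths, \<open>inverse_process A t \<omega> < z\<close> implies \<open>t < A z \<omega>\<close>, which in turn implies
  \<open>inverse_process A t \<omega> \<le> z\<close>. Equality has probability zero because of the density.
\<close>
lemma AE_inverse_process_less_iff:
  assumes A: "stable_subordinator M \<nu> A"
    and L: "distributed M lborel (inverse_process A t) g" and z: "0 \<le> z"
  shows "AE \<omega> in M. inverse_process A t \<omega> < z \<longleftrightarrow> t < A z \<omega>"
proof -
  interpret prob_space M by (rule stable_subordinatorD(1)[OF A])
  from AE_neq_if_distributed_lborel[OF L, of z] stable_subordinatorD(3)[OF A] stable_subordinator_unbounded[OF A, of t] show ?thesis
  proof eventually_elim
    case (elim \<omega>)
    let ?S = "{z. 0 \<le> z \<and> t < A z \<omega>}"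
    have bdd: "bdd_below ?S" by (rule bdd_belowI[of _ 0]) auto
    have ne: "?S \<noteq> {}" using elim by auto
    show ?case
    proof
      assume "inverse_process A t \<omega> < z"
      then obtain z' where "0 \<le> z'" "t < A z' \<omega>" "z' < z"
        using cInf_lessD[OF ne, of z] by (auto simp: inverse_process_def)
      moreover have "A z' \<omega> \<le> A z \<omega>"
        using elim z calculation by (intro mono_onD[of "{0..}" "\<lambda>z. A z \<omega>"]) auto
      ultimately show "t < A z \<omega>" by linarith
    next
      assume "t < A z \<omega>"
      hence "inverse_process A t \<omega> \<le> z"
        unfolding inverse_process_def using z by (intro cInf_lower bdd) auto
      thus "inverse_process A t \<omega> < z" using elim by simp
    qed
  qed
qed

lemma AE_inverse_process_pos:
  assumes A: "stable_subordinator M \<nu> A"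
    and L: "distributed M lborel (inverse_process A t) g" and t: "0 < t"
  shows "AE \<omega> in M. 0 < inverse_process A t \<omega>"
  using AE_neq_if_distributed_lborel[OF L, of 0] AE_inverse_process_less_iff[OF A L order_refl]
    stable_subordinatorD(3)[OF A]
  by eventually_elim (use t in auto)

text \<open>
  For \<open>x > 0\<close> and \<open>z = (t / x) powr \<nu>\<close> the rescaled variable exceeds \<open>x\<close> iff the inverse process is below
  \<open>z\<close>, that is, iff \<open>A z\<close> exceeds \<open>t\<close>; by self-similarity this is as likely as \<open>A 1\<close> exceeding \<open>x\<close>.
\<close>
lemma distr_rescaled_inverse_process:
  assumes A: "stable_subordinator M \<nu> A" and \<nu>: "0 < \<nu>"
    and L: "distributed M lborel (inverse_process A t) g" and t: "0 < t"
  shows "distr M borel (\<lambda>\<omega>. t * inverse_process A t \<omega> powr (- 1 / \<nu>)) = distr M borel (A 1)"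
proof -
  interpret prob_space M by (rule stable_subordinatorD(1)[OF A])
  let ?L = "inverse_process A t"
  have [measurable]: "?L \<in> borel_measurable M"
    using L by (simp add: distributed_def)
  have A_meas: "A z \<in> borel_measurable M" if "0 \<le> z" for z
    using stable_subordinatorD(2)[OF A] that by auto
  have [measurable]: "A 1 \<in> borel_measurable M" by (rule A_meas) auto
  define V where "V \<omega> = t * ?L \<omega> powr (- 1 / \<nu>)" for \<omega>
  have [measurable]: "V \<in> borel_measurable M" unfolding V_def by measurable
  have "emeasure M {\<omega> \<in> space M. x < V \<omega>} = emeasure M {\<omega> \<in> space M. x < A 1 \<omega>}" for x
  \<comment> \<open>for \<open>x \<le> 0\<close> both events are almost sure\<close>
  proof (cases "0 < x")
    case False
    have 1: "AE \<omega> in M. (\<omega> \<in> {\<omega> \<in> space M. x < V \<omega>}) = (\<omega> \<in> space M)"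
      using AE_inverse_process_pos[OF A L t]
    proof eventually_elim
      case (elim \<omega>)
      hence "0 < V \<omega>" using t by (simp add: V_def)
      thus ?case using False by auto
    qed
    have 2: "AE \<omega> in M. (\<omega> \<in> {\<omega> \<in> space M. x < A 1 \<omega>}) = (\<omega> \<in> space M)"
      using stable_subordinator_pos[OF A \<nu> zero_less_one] by eventually_elim (use False in auto)
    show ?thesis
      using emeasure_eq_AE[OF 1] emeasure_eq_AE[OF 2] by simp
  next
    case x: True
    define z where "z = (t / x) powr \<nu>"
    have z: "0 < z" using x t by (simp add: z_def)
    have zr: "z powr (1 / \<nu>) = t / x" using \<nu> x t by (simp add: z_def powr_powr)
    have [measurable]: "A z \<in> borel_measurable M" using z by (intro A_meas) auto
    have "AE \<omega> in M. (\<omega> \<in> {\<omega> \<in> space M. x < V \<omega>}) = (\<omega> \<in> {\<omega> \<in> space M. t < A z \<omega>})"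
      using AE_inverse_process_less_iff[OF A L less_imp_le[OF z]] AE_inverse_process_pos[OF A L t]
    proof eventually_elim
      case (elim \<omega>)
      have "x < V \<omega> \<longleftrightarrow> ?L \<omega> powr (1 / \<nu>) < t / x"
        using x elim(2) by (simp add: V_def powr_minus field_simps)
      also have "\<dots> \<longleftrightarrow> ?L \<omega> powr (1 / \<nu>) < z powr (1 / \<nu>)"
        by (simp add: zr)
      also have "\<dots> \<longleftrightarrow> ?L \<omega> < z"
        using elim(2) z \<nu> powr_less_mono2[of "1 / \<nu>" "?L \<omega>" z] powr_mono2[of "1 / \<nu>" z "?L \<omega>"]
        by (cases "?L \<omega> < z") auto
      finally show ?case using elim(1) by simp
    qed
    hence "emeasure M {\<omega> \<in> space M. x < V \<omega>} = emeasure M {\<omega> \<in> space M. t < A z \<omega>}"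
      by (intro emeasure_eq_AE) auto
    also have "\<dots> = emeasure (distr M borel (A z)) {t<..}"
      by (simp add: emeasure_distr vimage_def Int_def conj_commute)
    also have "\<dots> = emeasure M {\<omega> \<in> space M. t < t / x * A 1 \<omega>}"
      unfolding stable_subordinator_self_similar[OF A \<nu> z] zr
      by (simp add: emeasure_distr vimage_def Int_def conj_commute)
    also have "{\<omega> \<in> space M. t < t / x * A 1 \<omega>} = {\<omega> \<in> space M. x < A 1 \<omega>}"
      using x t by (auto simp: field_simps)
    finally show ?thesis .
  qed
  hence "distr M borel V = distr M borel (A 1)"
    by (intro measure_eqI_lessThan)
       (auto simp: emeasure_distr vimage_def Int_def conj_commute less_top[symmetric])
  thus ?thesis by (simp add: V_def[abs_def])
qed

text \<open>
  The inverse process at time \<open>t\<close> is distributed like \<open>t powr \<nu> * A 1 powr (-\<nu>)\<close>. This replaces the whole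
  process by one random variable whose dependence on \<open>t\<close> is explicit.
\<close>
lemma expectation_inverse_process:
  assumes A: "stable_subordinator M \<nu> A" and \<nu>: "0 < \<nu>"
    and L: "distributed M lborel (inverse_process A t) g" and t: "0 < t"
    and h [measurable]: "h \<in> borel_measurable (borel :: real measure)"
  shows "integral\<^sup>L M (\<lambda>\<omega>. h (inverse_process A t \<omega>)) = (integral\<^sup>L M (\<lambda>\<omega>. h (t powr \<nu> * A 1 \<omega> powr (-\<nu>))) :: real)"
proof -
  interpret prob_space M by (rule stable_subordinatorD(1)[OF A])
  let ?L = "inverse_process A t"
  have [measurable]: "?L \<in> borel_measurable M"
    using L by (simp add: distributed_def)
  have [measurable]: "A 1 \<in> borel_measurable M"
    using stable_subordinatorD(2)[OF A] by auto
  define V where "V \<omega> = t * ?L \<omega> powr (- 1 / \<nu>)" for \<omega>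
  have [measurable]: "V \<in> borel_measurable M" unfolding V_def by measurable
  define \<phi> where "\<phi> v = h (t powr \<nu> * v powr (-\<nu>))" for v
  have [measurable]: "\<phi> \<in> borel_measurable borel" unfolding \<phi>_def by measurable
  have "expectation (\<lambda>\<omega>. h (?L \<omega>)) = expectation (\<lambda>\<omega>. \<phi> (V \<omega>))"
  proof (rule integral_cong_AE)
    show "AE \<omega> in M. h (?L \<omega>) = \<phi> (V \<omega>)"
      using AE_inverse_process_pos[OF A L t]
    proof eventually_elim
      case (elim \<omega>)
      have "t powr \<nu> * V \<omega> powr (-\<nu>) = ?L \<omega>"
      proof -
        have "V \<omega> powr (-\<nu>) = t powr (-\<nu>) * ?L \<omega>"
          using elim t \<nu> by (simp add: V_def powr_mult powr_powr)
        thus ?thesis using t by (simp add: powr_minus)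
      qed
      thus ?case by (simp add: \<phi>_def)
    qed
  qed measurable
  also have "\<dots> = integral\<^sup>L (distr M borel V) \<phi>"
    by (rule integral_distr[symmetric]) auto
  also have "distr M borel V = distr M borel (A 1)"
    using distr_rescaled_inverse_process[OF A \<nu> L t] by (simp add: V_def[abs_def])
  also have "integral\<^sup>L (distr M borel (A 1)) \<phi> = expectation (\<lambda>\<omega>. \<phi> (A 1 \<omega>))"
    by (rule integral_distr) auto
  finally show ?thesis by (simp add: \<phi>_def)
qed

text \<open>
  With \<open>p = \<nu> * k\<close>, write \<open>Gamma p * A 1 powr (-p)\<close> as the integral of \<open>s powr (p - 1) * exp (- s * A 1)\<close>
  over positive \<open>s\<close>. Tonelli's theorem brings in the Laplace transform \<open>exp (- (s powr \<nu>))\<close>, and the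
  remaining integral equals \<open>Gamma k / \<nu>\<close>.
\<close>
lemma stable_subordinator_negative_moments:
  assumes A: "stable_subordinator M \<nu> A" and \<nu>: "0 < \<nu>"
  shows "has_bochner_integral M (\<lambda>\<omega>. (A 1 \<omega> powr (-\<nu>)) ^ k) (fact k / Gamma (1 + real k * \<nu>))"
proof (cases "k = 0")
  interpret prob_space M by (rule stable_subordinatorD(1)[OF A])
  case True
  thus ?thesis by (simp add: has_bochner_integral_iff prob_space)
next
  case False
  interpret prob_space M by (rule stable_subordinatorD(1)[OF A])
  interpret pair_sigma_finite lborel M ..
  have [measurable]: "A 1 \<in> borel_measurable M"
    using stable_subordinatorD(2)[OF A] by auto
  define p where "p = \<nu> * real k"
  have p: "0 < p" using False \<nu> by (simp add: p_def)
  have Gp: "0 < Gamma p" using p by (rule Gamma_real_pos)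
  have "(\<integral>\<^sup>+\<omega>. ennreal (Gamma p * (A 1 \<omega> powr (-\<nu>)) ^ k) \<partial>M)
      = (\<integral>\<^sup>+\<omega>. (\<integral>\<^sup>+s. ennreal (indicator {0<..} s * (s powr (p - 1) * exp (- (A 1 \<omega> * s)))) \<partial>lborel) \<partial>M)"
  proof (rule nn_integral_cong_AE)
    show "AE \<omega> in M. ennreal (Gamma p * (A 1 \<omega> powr (-\<nu>)) ^ k)
        = (\<integral>\<^sup>+s. ennreal (indicator {0<..} s * (s powr (p - 1) * exp (- (A 1 \<omega> * s)))) \<partial>lborel)"
      using stable_subordinator_pos[OF A \<nu> zero_less_one]
    proof eventually_elim
      case (elim \<omega>)
      have "(A 1 \<omega> powr (-\<nu>)) ^ k = A 1 \<omega> powr (-p)"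
        using elim by (simp add: p_def powr_powr flip: powr_realpow)
      hence "Gamma p * (A 1 \<omega> powr (-\<nu>)) ^ k = Gamma p * A 1 \<omega> powr (-p)"
        by (simp only:)
      also have "\<dots> = Gamma p / (1 * A 1 \<omega> powr p)"
        by (simp add: powr_minus divide_inverse)
      also have "ennreal \<dots> = (\<integral>\<^sup>+s. ennreal (indicator {0<..} s * (s powr (1 * p - 1) * exp (- (A 1 \<omega> * s powr 1)))) \<partial>lborel)"
        using elim p by (intro nn_integral_powr_exp_powr[symmetric]) auto
      also have "\<dots> = (\<integral>\<^sup>+s. ennreal (indicator {0<..} s * (s powr (p - 1) * exp (- (A 1 \<omega> * s)))) \<partial>lborel)"
        by (intro nn_integral_cong) (auto simp: indicator_def)
      finally show ?case .
    qed
  qed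
  also have "\<dots> = (\<integral>\<^sup>+s. (\<integral>\<^sup>+\<omega>. ennreal (indicator {0<..} s * (s powr (p - 1) * exp (- (A 1 \<omega> * s)))) \<partial>M) \<partial>lborel)"
    by (rule Fubini') measurable
  also have "\<dots> = (\<integral>\<^sup>+s. ennreal (indicator {0<..} s * (s powr (\<nu> * real k - 1) * exp (- (1 * s powr \<nu>)))) \<partial>lborel)"
  proof (rule nn_integral_cong)
    fix s :: real
    show "(\<integral>\<^sup>+\<omega>. ennreal (indicator {0<..} s * (s powr (p - 1) * exp (- (A 1 \<omega> * s)))) \<partial>M)
        = ennreal (indicator {0<..} s * (s powr (\<nu> * real k - 1) * exp (- (1 * s powr \<nu>))))"
    proof (cases "0 < s")
      case s: True
      have "(\<integral>\<^sup>+\<omega>. ennreal (s powr (p - 1) * exp (- s * A 1 \<omega>)) \<partial>M) = ennreal (\<integral>\<omega>. s powr (p - 1) * exp (- s * A 1 \<omega>) \<partial>M)"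
        using s by (intro nn_integral_eq_integral integrable_mult_right stable_subordinator_integrable_exp[OF A]) auto
      also have "(\<integral>\<omega>. s powr (p - 1) * exp (- s * A 1 \<omega>) \<partial>M) = s powr (p - 1) * exp (- (s powr \<nu>))"
        using s stable_subordinatorD(4)[OF A, of 1 s] by simp
      finally show ?thesis using s by (simp add: p_def mult.commute)
    qed simp
  qed
  also have "\<dots> = ennreal (Gamma (real k) / (\<nu> * 1 powr (real k)))"
    using False \<nu> by (intro nn_integral_powr_exp_powr) auto
  finally have "has_bochner_integral M (\<lambda>\<omega>. Gamma p * (A 1 \<omega> powr (-\<nu>)) ^ k) (Gamma (real k) / \<nu>)"
    using Gp False \<nu> by (intro has_bochner_integral_nn_integral) (auto intro!: divide_nonneg_nonneg less_imp_le[OF Gamma_real_pos])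
  hence "has_bochner_integral M (\<lambda>\<omega>. (1 / Gamma p) * (Gamma p * (A 1 \<omega> powr (-\<nu>)) ^ k)) ((1 / Gamma p) * (Gamma (real k) / \<nu>))"
    by (rule has_bochner_integral_mult_right)
  moreover have "(1 / Gamma p) * (Gamma (real k) / \<nu>) = fact k / Gamma (1 + real k * \<nu>)"
  proof -
    have "Gamma (1 + real k * \<nu>) = p * Gamma p"
    proof -
      have "Gamma (p + 1) = p * Gamma p" using p by (subst Gamma_plus1) auto
      thus ?thesis by (simp add: p_def add.commute mult.commute)
    qed
    moreover have "fact k = real k * Gamma (real k)"
    proof -
      have "Gamma (real k + 1) = real k * Gamma (real k)" using False by (subst Gamma_plus1) auto
      thus ?thesis by (simp add: Gamma_fact add.commute)
    qed
    ultimately show ?thesis using False \<nu> Gp by (simp add: p_def field_simps)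
  qed
  ultimately show ?thesis using Gp by simp
qed

section \<open>The fractional Gamma density\<close>

lemma gevrey_rGamma_appell:
  assumes "0 < \<sigma>" "\<sigma> \<le> 1/2"
  shows "gevrey \<sigma> (\<lambda>k. rGamma_appell k q)"
  using rGamma_appell_bound[OF assms, of "\<bar>q\<bar>"] unfolding gevrey_def by (metis abs_ge_zero order_refl)

lemma gamma_proc_density_eq:
  assumes "0 < b" "0 < x" "0 < z"
  shows "gamma_proc_density b x z = exp (- b * x) / x * (exp (ln (b * x) * z) * rGamma z)"
proof -
  have "b powr z * x powr (z - 1) = (b * x) powr z / x"
    using assms by (simp add: powr_mult powr_diff)
  also have "(b * x) powr z = exp (ln (b * x) * z)"
    using assms by (simp add: powr_def mult.commute)
  finally have "b powr z * x powr (z - 1) = exp (ln (b * x) * z) / x" .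
  hence "(b powr z * x powr (z - 1)) * exp (- b * x) * rGamma z = exp (ln (b * x) * z) / x * exp (- b * x) * rGamma z"
    by simp
  thus ?thesis
    using assms by (simp add: gamma_proc_density_def rGamma_inverse_Gamma divide_inverse mult_ac)
qed

text \<open>
  The \<open>k\<close>-th moment of \<open>A 1 powr (-\<nu>)\<close> is \<open>fact k / Gamma (1 + k * \<nu>)\<close>, so taking expectations in the
  Taylor series of \<open>h\<close> replaces the factorials by the Gamma factors of a fractional series.
\<close>
lemma expectation_entire_stable:
  assumes A: "stable_subordinator M \<nu> A" and \<nu>: "0 < \<nu>" and \<sigma>: "\<sigma> < \<nu>" and c: "gevrey \<sigma> c"
    and h: "\<And>z. (\<lambda>k. c k / fact k * z ^ k) sums h z" and t: "0 < t"
  shows "integral\<^sup>L M (\<lambda>\<omega>. h (t powr \<nu> * A 1 \<omega> powr (-\<nu>))) = frac_series \<nu> c t"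
proof -
  define Y where "Y \<omega> = A 1 \<omega> powr (-\<nu>)" for \<omega>
  define T where "T = t powr \<nu>"
  have T: "0 < T" using t by (simp add: T_def)
  have mom: "has_bochner_integral M (\<lambda>\<omega>. Y \<omega> ^ k) (fact k / Gamma (1 + real k * \<nu>))" for k
    unfolding Y_def by (rule stable_subordinator_negative_moments[OF A \<nu>])
  define f where "f k \<omega> = c k / fact k * (T * Y \<omega>) ^ k" for k \<omega>
  have int: "has_bochner_integral M (f k) (c k * T ^ k / Gamma (1 + real k * \<nu>))" for k
  proof -
    have "has_bochner_integral M (\<lambda>\<omega>. (c k / fact k * T ^ k) * Y \<omega> ^ k)
       ((c k / fact k * T ^ k) * (fact k / Gamma (1 + real k * \<nu>)))"
      by (rule has_bochner_integral_mult_right) (rule mom)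
    thus ?thesis by (simp add: f_def[abs_def] power_mult_distrib mult_ac)
  qed
  have int_norm: "has_bochner_integral M (\<lambda>\<omega>. norm (f k \<omega>)) (\<bar>c k\<bar> * T ^ k / Gamma (1 + real k * \<nu>))" for k
  proof -
    have "has_bochner_integral M (\<lambda>\<omega>. (\<bar>c k\<bar> / fact k * T ^ k) * Y \<omega> ^ k)
       ((\<bar>c k\<bar> / fact k * T ^ k) * (fact k / Gamma (1 + real k * \<nu>)))"
      by (rule has_bochner_integral_mult_right) (rule mom)
    moreover have "(\<lambda>\<omega>. norm (f k \<omega>)) = (\<lambda>\<omega>. (\<bar>c k\<bar> / fact k * T ^ k) * Y \<omega> ^ k)"
      using T by (simp add: fun_eq_iff f_def abs_mult power_abs power_mult_distrib Y_def)
    ultimately show ?thesis by (simp add: mult_ac)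
  qed
  have summ1: "summable (\<lambda>k. norm (f k \<omega>))" for \<omega>
    unfolding f_def
    by (rule powser_insidea[of _ "\<bar>T * Y \<omega>\<bar> + 1"]) (use h in \<open>auto simp: sums_iff\<close>)
  have summ2: "summable (\<lambda>k. integral\<^sup>L M (\<lambda>\<omega>. norm (f k \<omega>)))"
    unfolding has_bochner_integral_integral_eq[OF int_norm]
    by (rule summable_gevrey[OF c \<sigma> \<nu>]) (use T in simp)
  have "integral\<^sup>L M (\<lambda>\<omega>. h (T * Y \<omega>)) = integral\<^sup>L M (\<lambda>\<omega>. \<Sum>k. f k \<omega>)"
    using h by (simp add: f_def sums_iff)
  also have "\<dots> = (\<Sum>k. integral\<^sup>L M (f k))"
    by (rule integral_suminf[OF _ _ summ2]) (use int summ1 in \<open>auto simp: has_bochner_integral_iff\<close>)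
  also have "\<dots> = frac_series \<nu> c t"
    by (simp only: has_bochner_integral_integral_eq[OF int] frac_series_def T_def)
  finally show ?thesis by (simp add: T_def Y_def)
qed

text \<open>
  The integral against the density of the inverse process is an expectation, to which the series
  expansion in the time parameter of the Gamma density applies.
\<close>
lemma fractional_gamma_density_eq_frac_series:
  assumes A: "stable_subordinator M \<nu> A" and \<nu>: "0 < \<nu>" and b: "0 < b" and x: "0 < x" and t: "0 < t"
    and L: "distributed M lborel (inverse_process A t) (\<lambda>z. ennreal (l z))" and l: "\<And>z. 0 \<le> l z"
  shows "(LBINT z:{0<..}. gamma_proc_density b x z * l z)
       = exp (- b * x) / x * frac_series \<nu> (\<lambda>k. rGamma_appell k (ln (b * x))) t"
proof -
  define h where "h z = exp (ln (b * x) * z) * rGamma z" for z :: real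
  define \<sigma> where "\<sigma> = min (\<nu> / 2) (1 / 2)"
  have \<sigma>: "0 < \<sigma>" "\<sigma> \<le> 1/2" "\<sigma> < \<nu>" using \<nu> by (auto simp: \<sigma>_def)
  have h_cont: "continuous_on UNIV h"
    unfolding h_def by (intro continuous_intros)
  have [measurable]: "h \<in> borel_measurable borel"
    using borel_measurable_continuous_onI[OF h_cont] .
  define g where "g z = indicator {0<..} z * (exp (- b * x) / x * h z)" for z
  have "(LBINT z:{0<..}. gamma_proc_density b x z * l z) = (\<integral>z. l z * g z \<partial>lborel)"
    unfolding set_lebesgue_integral_def
    by (intro Bochner_Integration.integral_cong) 
       (use gamma_proc_density_eq[OF b x] in \<open>auto simp: g_def h_def indicator_def\<close>)
  also have "\<dots> = integral\<^sup>L M (\<lambda>\<omega>. g (inverse_process A t \<omega>))"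
    by (rule distributed_integral[OF L]) (use l in \<open>auto simp: g_def\<close>)
  also have "\<dots> = integral\<^sup>L M (\<lambda>\<omega>. g (t powr \<nu> * A 1 \<omega> powr (-\<nu>)))"
    by (rule expectation_inverse_process[OF A \<nu> L t]) (simp add: g_def)
  also have "\<dots> = integral\<^sup>L M (\<lambda>\<omega>. exp (- b * x) / x * h (t powr \<nu> * A 1 \<omega> powr (-\<nu>)))"
  proof (rule integral_cong_AE)
    have [measurable]: "A 1 \<in> borel_measurable M"
      using stable_subordinatorD(2)[OF A] by auto
    show "(\<lambda>\<omega>. g (t powr \<nu> * A 1 \<omega> powr (-\<nu>))) \<in> borel_measurable M"
      "(\<lambda>\<omega>. exp (- b * x) / x * h (t powr \<nu> * A 1 \<omega> powr (-\<nu>))) \<in> borel_measurable M"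
      unfolding g_def by measurable
    show "AE \<omega> in M. g (t powr \<nu> * A 1 \<omega> powr (-\<nu>)) = exp (- b * x) / x * h (t powr \<nu> * A 1 \<omega> powr (-\<nu>))"
      using stable_subordinator_pos[OF A \<nu> zero_less_one]
      by eventually_elim (use t in \<open>auto simp: g_def\<close>)
  qed
  also have "\<dots> = exp (- b * x) / x * integral\<^sup>L M (\<lambda>\<omega>. h (t powr \<nu> * A 1 \<omega> powr (-\<nu>)))"
    by simp
  also have "integral\<^sup>L M (\<lambda>\<omega>. h (t powr \<nu> * A 1 \<omega> powr (-\<nu>)))
      = frac_series \<nu> (\<lambda>k. rGamma_appell k (ln (b * x))) t"
    unfolding h_def
    by (rule expectation_entire_stable[OF A \<nu> \<sigma>(3) gevrey_rGamma_appell[OF \<sigma>(1,2)] rGamma_appell_sums t])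
  finally show ?thesis .
qed

text \<open>
  The coefficient bounds are uniform for \<open>q\<close> in a bounded interval and provide a Weierstrass majorant
  for the differentiated series; doubling the base \<open>E\<close> absorbs the factor \<open>k\<close>.
\<close>
lemma has_real_derivative_frac_series_appell:
  assumes \<nu>: "0 < \<nu>"
  shows "((\<lambda>q. frac_series \<nu> (\<lambda>k. rGamma_appell k q) t) has_real_derivative
           frac_series \<nu> (\<lambda>k. real k * rGamma_appell (k - 1) q) t) (at q)"
    and "summable (\<lambda>k. real k * rGamma_appell (k - 1) q * (t powr \<nu>) ^ k / Gamma (1 + real k * \<nu>))"
proof -
  define \<sigma> where "\<sigma> = min (\<nu> / 2) (1 / 2)"
  have \<sigma>: "0 < \<sigma>" "\<sigma> \<le> 1/2" "\<sigma> < \<nu>" using \<nu> by (auto simp: \<sigma>_def)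
  define T where "T = t powr \<nu>"
  have T: "0 \<le> T" by (simp add: T_def)
  define Q where "Q = \<bar>q\<bar> + 1"
  obtain D E where DE: "D \<ge> 0" "E \<ge> 1" "\<And>q k. \<bar>q\<bar> \<le> Q \<Longrightarrow> \<bar>rGamma_appell k q\<bar> \<le> D * E ^ k * fact k powr \<sigma>"
    using rGamma_appell_bound[OF \<sigma>(1,2), of Q] by (auto simp: Q_def)
  have pos: "Gamma (1 + real k * \<nu>) > 0" for k
    using \<nu> by (intro Gamma_real_pos add_pos_nonneg) auto
  define m where "m k = D * ((2 * E) ^ k * fact k powr \<sigma> * T ^ k / Gamma (1 + real k * \<nu>))" for k
  have m: "summable m"
    unfolding m_def using \<sigma> \<nu> T DE by (intro summable_mult summable_gevrey_bound) auto
  have bound: "norm (real k * rGamma_appell (k - 1) q' * T ^ k / Gamma (1 + real k * \<nu>)) \<le> m k"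
    if q': "\<bar>q'\<bar> \<le> Q" for k q'
  proof -
    have "\<bar>real k * rGamma_appell (k - 1) q'\<bar> = real k * \<bar>rGamma_appell (k - 1) q'\<bar>"
      by (simp add: abs_mult)
    also have "\<dots> \<le> 2 ^ k * (D * E ^ k * fact k powr \<sigma>)"
    proof (rule mult_mono)
      have "\<bar>rGamma_appell (k - 1) q'\<bar> \<le> D * E ^ (k - 1) * fact (k - 1) powr \<sigma>"
        by (rule DE(3)[OF q'])
      also have "\<dots> \<le> D * E ^ k * fact k powr \<sigma>"
        using DE \<sigma> by (intro mult_mono mult_left_mono power_increasing powr_mono2) (auto intro: fact_mono)
      finally show "\<bar>rGamma_appell (k - 1) q'\<bar> \<le> D * E ^ k * fact k powr \<sigma>" .
    qed (auto simp: of_nat_less_two_power less_imp_le)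
    finally have "\<bar>real k * rGamma_appell (k - 1) q'\<bar> * (T ^ k / Gamma (1 + real k * \<nu>))
        \<le> 2 ^ k * (D * E ^ k * fact k powr \<sigma>) * (T ^ k / Gamma (1 + real k * \<nu>))"
      using T pos[of k] by (intro mult_right_mono) auto
    also have "\<dots> = m k"
      by (simp add: m_def power_mult_distrib mult_ac)
    also have "\<bar>real k * rGamma_appell (k - 1) q'\<bar> * (T ^ k / Gamma (1 + real k * \<nu>))
       = norm (real k * rGamma_appell (k - 1) q' * T ^ k / Gamma (1 + real k * \<nu>))"
      using T pos[of k] by (simp add: abs_mult power_abs)
    finally show ?thesis .
  qed
  show "summable (\<lambda>k. real k * rGamma_appell (k - 1) q * (t powr \<nu>) ^ k / Gamma (1 + real k * \<nu>))"
    unfolding T_def[symmetric]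
    by (rule summable_comparison_test'[OF m]) (rule bound, simp add: Q_def)
  let ?S = "{-Q..Q}"
  have "((\<lambda>q. \<Sum>k. rGamma_appell k q * T ^ k / Gamma (1 + real k * \<nu>)) has_real_derivative
           (\<Sum>k. real k * rGamma_appell (k - 1) q * T ^ k / Gamma (1 + real k * \<nu>))) (at q)"
  proof (rule has_field_derivative_series'(2)[of ?S _ _ q])
    show "((\<lambda>q. rGamma_appell k q * T ^ k / Gamma (1 + real k * \<nu>)) has_real_derivative
        real k * rGamma_appell (k - 1) q' * T ^ k / Gamma (1 + real k * \<nu>)) (at q' within ?S)" for k q'
      by (intro DERIV_cdivide DERIV_cmult_right has_field_derivative_at_within[OF has_real_derivative_rGamma_appell])
    show "uniformly_convergent_on ?S (\<lambda>n q. \<Sum>k<n. real k * rGamma_appell (k - 1) q * T ^ k / Gamma (1 + real k * \<nu>))"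
      by (rule Weierstrass_m_test'[OF bound m]) auto
    show "summable (\<lambda>k. rGamma_appell k q * T ^ k / Gamma (1 + real k * \<nu>))"
      using summable_gevrey_power[OF gevrey_rGamma_appell[OF \<sigma>(1,2)] \<sigma>(3) \<nu>, of q T] by simp
    show "q \<in> interior ?S" by (simp add: Q_def interior_atLeastAtMost_real abs_if)
  qed (auto simp: Q_def)
  thus "((\<lambda>q. frac_series \<nu> (\<lambda>k. rGamma_appell k q) t) has_real_derivative
           frac_series \<nu> (\<lambda>k. real k * rGamma_appell (k - 1) q) t) (at q)"
    by (simp add: frac_series_def T_def)
qed

lemma frac_series_cmult:
  assumes "summable (\<lambda>k. c k * (t powr \<nu>) ^ k / Gamma (1 + real k * \<nu>))"
  shows "frac_series \<nu> (\<lambda>k. a * c k) t = a * frac_series \<nu> c t"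
  using suminf_mult[OF assms, of a] by (simp add: frac_series_def mult.assoc)

lemma frac_series_diff:
  assumes "summable (\<lambda>k. c k * (t powr \<nu>) ^ k / Gamma (1 + real k * \<nu>))"
    and "summable (\<lambda>k. d k * (t powr \<nu>) ^ k / Gamma (1 + real k * \<nu>))"
  shows "frac_series \<nu> (\<lambda>k. c k - d k) t = frac_series \<nu> c t - frac_series \<nu> d t"
  using suminf_diff[OF assms] by (simp add: frac_series_def left_diff_distrib diff_divide_distrib)

theorem theorem3:
  fixes M :: "'a measure" and b \<nu> :: real
    and G A L :: "real \<Rightarrow> 'a \<Rightarrow> real"
    and l f :: "real \<Rightarrow> real \<Rightarrow> real"
  assumes b: "b > 0" and \<nu>: "0 < \<nu>" "\<nu> < 1"
    and G: "gamma_subordinator M b G"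
    and A: "stable_subordinator M \<nu> A"
    and L: "L = inverse_process A"
    and indep: "indep_processes M G L"
    and l_nonneg: "\<And>z t. 0 \<le> l z t"
    and l_density: "\<And>t. 0 < t \<Longrightarrow> distributed M lborel (L t) (\<lambda>z. ennreal (l z t))"
    and f_density: "\<And>t. 0 < t \<Longrightarrow>
          distributed M lborel (\<lambda>\<omega>. G (L t \<omega>) \<omega>) (\<lambda>x. ennreal (f x t))"
    and f_formula: "\<And>x t. 0 < t \<Longrightarrow>
          f x t = (LBINT z:{0<..}. gamma_proc_density b x z * l z t)"
  shows "\<forall>t>1.
           (\<forall>x>0. frac_shift_exists \<nu> (-1) (\<lambda>s. f x s) t \<and>
              ((\<lambda>y. f y t) has_real_derivative
                 - b * (f x t - frac_shift \<nu> (-1) (\<lambda>s. f x s) t)) (at x)) \<and>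
           f 0 t = 0"
proof (intro allI impI conjI)
  fix t :: real assume "1 < t"
  hence t: "0 < t" by simp
  show "f 0 t = 0"
    by (simp add: f_formula[OF t] gamma_proc_density_def set_lebesgue_integral_def)
  fix x :: real assume x: "0 < x"
  define q where "q = ln (b * x)"
  define e where "e = exp (- b * x) / x"
  define \<Phi> where "\<Phi> q s = frac_series \<nu> (\<lambda>k. rGamma_appell k q) s" for q s
  define \<Phi>' where "\<Phi>' = frac_series \<nu> (\<lambda>k. real k * rGamma_appell (k - 1) q) t"
  define \<sigma> where "\<sigma> = min (\<nu> / 2) (1 / 2)"
  have \<sigma>: "0 < \<sigma>" "\<sigma> \<le> 1/2" "\<sigma> < \<nu>" using \<nu> by (auto simp: \<sigma>_def)
  have f_eq: "f y s = exp (- b * y) / y * \<Phi> (ln (b * y)) s" if "0 < y" "0 < s" for y s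
    unfolding \<Phi>_def f_formula[OF that(2)]
    by (rule fractional_gamma_density_eq_frac_series[OF A \<nu>(1) b that])
       (use l_density[OF that(2)] l_nonneg L in auto)

  \<comment> \<open>\<open>c k\<close> is the \<open>k\<close>-th derivative at 0 of the Gamma density in its time parameter\<close>
  define c where "c k = e * rGamma_appell k q" for k
  have summ: "summable (\<lambda>k. rGamma_appell k q * (s powr \<nu>) ^ k / Gamma (1 + real k * \<nu>))" for s
    using summable_gevrey_power[OF gevrey_rGamma_appell[OF \<sigma>(1,2)] \<sigma>(3) \<nu>(1), of q "s powr \<nu>"] by simp
  have c: "gevrey \<sigma> c"
  proof -
    obtain D E where DE: "D \<ge> 0" "E \<ge> 1" "\<And>k. \<bar>rGamma_appell k q\<bar> \<le> D * E ^ k * fact k powr \<sigma>"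
      using gevrey_rGamma_appell[OF \<sigma>(1,2), of q] unfolding gevrey_def by blast
    have "\<bar>c k\<bar> \<le> (\<bar>e\<bar> * D) * E ^ k * fact k powr \<sigma>" for k
      using mult_left_mono[OF DE(3)[of k], of "\<bar>e\<bar>"] by (simp add: c_def abs_mult mult_ac)
    thus ?thesis unfolding gevrey_def using DE by (metis abs_ge_zero mult_nonneg_nonneg)
  qed
  have u: "f x s = frac_series \<nu> c s" if "0 < s" for s
    unfolding c_def f_eq[OF x that] using frac_series_cmult[OF summ, of e s] by (simp add: \<Phi>_def e_def q_def)
  note shift = frac_shift_frac_series[OF c less_imp_le[OF \<sigma>(1)] \<sigma>(3) \<nu>, of "\<lambda>s. f x s" t]
  show "frac_shift_exists \<nu> (-1) (\<lambda>s. f x s) t"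
    by (rule shift(1)) (use u t in auto)
  \<comment> \<open>the coefficients of the Gamma density shifted by \<open>-1\<close> in time\<close>
  have coeff: "(\<Sum>n. (-1) ^ n / fact n * c (k + n)) =
      (e * exp (-q)) * (real k * rGamma_appell (k - 1) q - rGamma_appell k q)" for k
    using sums_mult[OF rGamma_appell_shift_sums[of k q], of e]
    by (simp add: c_def sums_iff mult_ac)
  have summ': "summable (\<lambda>k. real k * rGamma_appell (k - 1) q * (t powr \<nu>) ^ k / Gamma (1 + real k * \<nu>))"
    by (rule has_real_derivative_frac_series_appell(2)[OF \<nu>(1)])
  have "frac_shift \<nu> (-1) (\<lambda>s. f x s) t = frac_series \<nu> (\<lambda>k. \<Sum>n. (-1) ^ n / fact n * c (k + n)) t"
    by (rule shift(2)) (use u t in auto)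
  also have "\<dots> = (e * exp (-q)) * frac_series \<nu> (\<lambda>k. real k * rGamma_appell (k - 1) q - rGamma_appell k q) t"
    unfolding coeff using summable_diff[OF summ' summ[of t]]
    by (intro frac_series_cmult) (simp add: left_diff_distrib diff_divide_distrib)
  also have "\<dots> = (e * exp (-q)) * (\<Phi>' - \<Phi> q t)"
    unfolding frac_series_diff[OF summ' summ] \<Phi>'_def \<Phi>_def ..
  also have "exp (-q) = 1 / (b * x)"
    using b x by (simp add: q_def exp_minus divide_inverse)
  finally have shift_eq: "frac_shift \<nu> (-1) (\<lambda>s. f x s) t = e / (b * x) * (\<Phi>' - \<Phi> q t)"
    by simp

  \<comment> \<open>\<open>x\<close> enters through \<open>e\<close> and through \<open>q = ln (b * x)\<close>; the latter part gives \<open>\<Phi>'\<close>, as in \<open>shift_eq\<close>\<close>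
  have d\<Phi>: "((\<lambda>q. \<Phi> q t) has_real_derivative \<Phi>') (at (ln (b * x)))"
    unfolding \<Phi>_def \<Phi>'_def q_def by (rule has_real_derivative_frac_series_appell(1)[OF \<nu>(1)])
  have dln: "((\<lambda>y. ln (b * y)) has_real_derivative 1 / x) (at x)"
    using b x by (auto intro!: derivative_eq_intros)
  have "((\<lambda>y. exp (- b * y) / y) has_real_derivative - b * e - e / x) (at x)"
    using x by (auto intro!: derivative_eq_intros simp: e_def field_simps power2_eq_square)
  from DERIV_mult[OF this DERIV_chain2[OF d\<Phi> dln]]
  have "((\<lambda>y. exp (- b * y) / y * \<Phi> (ln (b * y)) t) has_real_derivative
      (- b * e - e / x) * \<Phi> q t + \<Phi>' * (1 / x) * e) (at x)"
    by (simp add: q_def e_def)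
  hence "((\<lambda>y. f y t) has_real_derivative (- b * e - e / x) * \<Phi> q t + \<Phi>' * (1 / x) * e) (at x)"
    by (rule has_field_derivative_transform_within_open[of _ _ _ "{0<..}"]) (use x f_eq t in auto)
  also have "(- b * e - e / x) * \<Phi> q t + \<Phi>' * (1 / x) * e
      = - b * (f x t - frac_shift \<nu> (-1) (\<lambda>s. f x s) t)"
  proof -
    have "f x t = e * \<Phi> q t"
      using f_eq[OF x t] by (simp add: e_def q_def)
    thus ?thesis
      unfolding shift_eq using b x by (simp add: field_simps)
  qed
  finally show "((\<lambda>y. f y t) has_real_derivative
                 - b * (f x t - frac_shift \<nu> (-1) (\<lambda>s. f x s) t)) (at x)" .
qed

end
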